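(* Let $(P,Q)$ be a harmonious quasi-projection pair on a Hilbert $C^*$-module $H$ with $P$ non-trivial. Then $H_5\neq\{0\}$ if and only if $H_6\neq\{0\}$, which occurs if and only if $Q\neq Q^*$. In this case, $$U_{P,Q}PU_{P,Q}^*=I_{H_1}\oplus I_{H_2}\oplus 0_{H_3}\oplus 0_{H_4}\oplus I_{H_5}\oplus 0_{H_6},\qquad U_{P,Q}QU_{P,Q}^*=I_{H_1}\oplus 0_{H_2}\oplus I_{H_3}\oplus 0_{H_4}\oplus\widehat{Q},$$ where $$\widehat{Q}=\begin{pmatrix} A & -\ell(A)U^*\\ U\ell(A) & U(I_{H_5}-A)U^*\end{pmatrix}\in\mathcal{L}(H_5\oplus H_6),$$ for some self-adjoint $A\in\mathcal{L}(H_5)$ with $A^2-A\ge0$ and $\overline{\mathcal{R}(A^2-A)}=H_5$, and some unitary operator $U\in\mathcal{L}(H_5,H_6)$.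
   Context: $H$ is a Hilbert module over a $C^*$-algebra, $\mathcal{L}(H)$ the adjointable operators; projections are self-adjoint idempotents; $P$ non-trivial means $P\neq0,I$. A quasi-projection pair is $(P,Q)$ with $P$ a projection, $Q$ an idempotent and $Q^*=(2P-I)Q(2P-I)$; it is harmonious if $\overline{\mathcal{R}(PQ(I-P))}$ and $\overline{\mathcal{R}((I-P)QP)}$ are orthogonally complemented in $H$. Define $H_1=\mathcal{R}(P)\cap\mathcal{R}(Q)$, $H_2=\mathcal{R}(P)\cap\mathcal{N}(Q)$, $H_3=\mathcal{N}(P)\cap\mathcal{R}(Q)$, $H_4=\mathcal{N}(P)\cap\mathcal{N}(Q)$, $H_5=\overline{\mathcal{R}(PQ(I-P))}$, $H_6=\overline{\mathcal{R}((I-P)QP)}$. For a harmonious quasi-projection pair these are mutually orthogonal, orthogonally complemented, and $P=P_{H_1}+P_{H_2}+P_{H_5}$, $I-P=P_{H_3}+P_{H_4}+P_{H_6}$, so $U_{P,Q}:H\to\bigoplus_{i=1}^6H_i$, $x\mapsto(P_{H_1}x,\dots,P_{H_6}x)^T$ is unitary. $\ell(A)=(A^2-A)^{1/2}$; $\oplus$ denotes block-diagonal sums. *)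

theory Defs
  imports "HOL-Analysis.Analysis"
begin

record 'a cstar_alg =
  ca_add  :: "'a \<Rightarrow> 'a \<Rightarrow> 'a"
  ca_zero :: 'a
  ca_smul :: "complex \<Rightarrow> 'a \<Rightarrow> 'a"
  ca_mult :: "'a \<Rightarrow> 'a \<Rightarrow> 'a"
  ca_star :: "'a \<Rightarrow> 'a"
  ca_norm :: "'a \<Rightarrow> real"

definition complex_vs :: "('v \<Rightarrow> 'v \<Rightarrow> 'v) \<Rightarrow> 'v \<Rightarrow> (complex \<Rightarrow> 'v \<Rightarrow> 'v) \<Rightarrow> bool" where
  "complex_vs ad z sm \<longleftrightarrow>
     (\<forall>x y w. ad (ad x y) w = ad x (ad y w)) \<and> (\<forall>x y. ad x y = ad y x) \<and>
     (\<forall>x. ad x z = x) \<and> (\<forall>x. ad x (sm (-1) x) = z) \<and> (\<forall>x. sm 1 x = x) \<and>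
     (\<forall>a b x. sm a (sm b x) = sm (a * b) x) \<and>
     (\<forall>a x y. sm a (ad x y) = ad (sm a x) (sm a y)) \<and>
     (\<forall>a b x. sm (a + b) x = ad (sm a x) (sm b x))"

definition vminus :: "('v \<Rightarrow> 'v \<Rightarrow> 'v) \<Rightarrow> (complex \<Rightarrow> 'v \<Rightarrow> 'v) \<Rightarrow> 'v \<Rightarrow> 'v \<Rightarrow> 'v" where
  "vminus ad sm x y = ad x (sm (-1) y)"

definition complex_banach ::
  "('v \<Rightarrow> 'v \<Rightarrow> 'v) \<Rightarrow> 'v \<Rightarrow> (complex \<Rightarrow> 'v \<Rightarrow> 'v) \<Rightarrow> ('v \<Rightarrow> real) \<Rightarrow> bool" where
  "complex_banach ad z sm nr \<longleftrightarrow> complex_vs ad z sm \<and>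
     (\<forall>x. 0 \<le> nr x) \<and> (\<forall>x. nr x = 0 \<longleftrightarrow> x = z) \<and>
     (\<forall>a x. nr (sm a x) = cmod a * nr x) \<and> (\<forall>x y. nr (ad x y) \<le> nr x + nr y) \<and>
     (\<forall>X::nat \<Rightarrow> 'v. (\<forall>e>0. \<exists>N. \<forall>m\<ge>N. \<forall>n\<ge>N. nr (vminus ad sm (X m) (X n)) < e)
        \<longrightarrow> (\<exists>L. (\<lambda>n. nr (vminus ad sm (X n) L)) \<longlonglongrightarrow> 0))"

definition cstar_algebra :: "'a cstar_alg \<Rightarrow> bool" where
  "cstar_algebra A \<longleftrightarrow>
     complex_banach (ca_add A) (ca_zero A) (ca_smul A) (ca_norm A) \<and>
     (\<forall>x y w. ca_mult A (ca_mult A x y) w = ca_mult A x (ca_mult A y w)) \<and>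
     (\<forall>x y w. ca_mult A (ca_add A x y) w = ca_add A (ca_mult A x w) (ca_mult A y w)) \<and>
     (\<forall>x y w. ca_mult A x (ca_add A y w) = ca_add A (ca_mult A x y) (ca_mult A x w)) \<and>
     (\<forall>c x y. ca_smul A c (ca_mult A x y) = ca_mult A (ca_smul A c x) y) \<and>
     (\<forall>c x y. ca_smul A c (ca_mult A x y) = ca_mult A x (ca_smul A c y)) \<and>
     (\<forall>x y. ca_norm A (ca_mult A x y) \<le> ca_norm A x * ca_norm A y) \<and>
     (\<forall>x. ca_star A (ca_star A x) = x) \<and>
     (\<forall>x y. ca_star A (ca_add A x y) = ca_add A (ca_star A x) (ca_star A y)) \<and>
     (\<forall>c x. ca_star A (ca_smul A c x) = ca_smul A (cnj c) (ca_star A x)) \<and>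
     (\<forall>x y. ca_star A (ca_mult A x y) = ca_mult A (ca_star A y) (ca_star A x)) \<and>
     (\<forall>x. ca_norm A (ca_mult A (ca_star A x) x) = (ca_norm A x)\<^sup>2)"

definition ca_pos :: "'a cstar_alg \<Rightarrow> 'a \<Rightarrow> bool" where
  "ca_pos A a \<longleftrightarrow> (\<exists>b. a = ca_mult A (ca_star A b) b)"

record ('m, 'a) hilb_mod =
  hm_add   :: "'m \<Rightarrow> 'm \<Rightarrow> 'm"
  hm_zero  :: 'm
  hm_smul  :: "complex \<Rightarrow> 'm \<Rightarrow> 'm"
  hm_act   :: "'m \<Rightarrow> 'a \<Rightarrow> 'm"
  hm_inner :: "'m \<Rightarrow> 'm \<Rightarrow> 'a"

definition hm_norm :: "'a cstar_alg \<Rightarrow> ('m, 'a) hilb_mod \<Rightarrow> 'm \<Rightarrow> real" where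
  "hm_norm A H x = sqrt (ca_norm A (hm_inner H x x))"

definition hm_minus :: "('m, 'a) hilb_mod \<Rightarrow> 'm \<Rightarrow> 'm \<Rightarrow> 'm" where
  "hm_minus H x y = vminus (hm_add H) (hm_smul H) x y"

definition hilbert_module :: "'a cstar_alg \<Rightarrow> ('m, 'a) hilb_mod \<Rightarrow> bool" where
  "hilbert_module A H \<longleftrightarrow> cstar_algebra A \<and>
     complex_vs (hm_add H) (hm_zero H) (hm_smul H) \<and>
     (\<forall>x y a. hm_act H (hm_add H x y) a = hm_add H (hm_act H x a) (hm_act H y a)) \<and>
     (\<forall>x a b. hm_act H x (ca_add A a b) = hm_add H (hm_act H x a) (hm_act H x b)) \<and>
     (\<forall>x a b. hm_act H (hm_act H x a) b = hm_act H x (ca_mult A a b)) \<and>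
     (\<forall>c x a. hm_smul H c (hm_act H x a) = hm_act H (hm_smul H c x) a) \<and>
     (\<forall>c x a. hm_smul H c (hm_act H x a) = hm_act H x (ca_smul A c a)) \<and>
     (\<forall>x y w. hm_inner H x (hm_add H y w) = ca_add A (hm_inner H x y) (hm_inner H x w)) \<and>
     (\<forall>c x y. hm_inner H x (hm_smul H c y) = ca_smul A c (hm_inner H x y)) \<and>
     (\<forall>x y a. hm_inner H x (hm_act H y a) = ca_mult A (hm_inner H x y) a) \<and>
     (\<forall>x y. hm_inner H y x = ca_star A (hm_inner H x y)) \<and>
     (\<forall>x. ca_pos A (hm_inner H x x)) \<and>
     (\<forall>x. hm_inner H x x = ca_zero A \<longrightarrow> x = hm_zero H) \<and>
     (\<forall>X::nat \<Rightarrow> 'm. (\<forall>e>0. \<exists>N. \<forall>m\<ge>N. \<forall>n\<ge>N. hm_norm A H (hm_minus H (X m) (X n)) < e)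
        \<longrightarrow> (\<exists>L. (\<lambda>n. hm_norm A H (hm_minus H (X n) L)) \<longlonglongrightarrow> 0))"

definition adjointable :: "('m, 'a) hilb_mod \<Rightarrow> ('m \<Rightarrow> 'm) \<Rightarrow> bool" where
  "adjointable H T \<longleftrightarrow> (\<exists>S. \<forall>x y. hm_inner H (T x) y = hm_inner H x (S y))"

definition adj :: "('m, 'a) hilb_mod \<Rightarrow> ('m \<Rightarrow> 'm) \<Rightarrow> ('m \<Rightarrow> 'm)" where
  "adj H T = (SOME S. \<forall>x y. hm_inner H (T x) y = hm_inner H x (S y))"

definition is_projection :: "('m, 'a) hilb_mod \<Rightarrow> ('m \<Rightarrow> 'm) \<Rightarrow> bool" where
  "is_projection H P \<longleftrightarrow> adjointable H P \<and> P \<circ> P = P \<and> adj H P = P"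

definition is_idempotent :: "('m, 'a) hilb_mod \<Rightarrow> ('m \<Rightarrow> 'm) \<Rightarrow> bool" where
  "is_idempotent H Q \<longleftrightarrow> adjointable H Q \<and> Q \<circ> Q = Q"

definition refl_op :: "('m, 'a) hilb_mod \<Rightarrow> ('m \<Rightarrow> 'm) \<Rightarrow> ('m \<Rightarrow> 'm)" where
  "refl_op H P = (\<lambda>x. hm_minus H (hm_add H (P x) (P x)) x)"

definition quasi_projection_pair :: "('m, 'a) hilb_mod \<Rightarrow> ('m \<Rightarrow> 'm) \<Rightarrow> ('m \<Rightarrow> 'm) \<Rightarrow> bool" where
  "quasi_projection_pair H P Q \<longleftrightarrow> is_projection H P \<and> is_idempotent H Q \<and>
     adj H Q = refl_op H P \<circ> Q \<circ> refl_op H P"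

definition ker_op :: "('m, 'a) hilb_mod \<Rightarrow> ('m \<Rightarrow> 'm) \<Rightarrow> 'm set" where
  "ker_op H T = {x. T x = hm_zero H}"

definition hm_closure :: "'a cstar_alg \<Rightarrow> ('m, 'a) hilb_mod \<Rightarrow> 'm set \<Rightarrow> 'm set" where
  "hm_closure A H S = {x. \<exists>X::nat \<Rightarrow> 'm. (\<forall>n. X n \<in> S) \<and>
                          (\<lambda>n. hm_norm A H (hm_minus H (X n) x)) \<longlonglongrightarrow> 0}"

definition orth :: "('m, 'a) hilb_mod \<Rightarrow> 'm set \<Rightarrow> 'm set" where
  "orth H M = {y. \<forall>x\<in>M. hm_inner H x y = hm_inner H (hm_zero H) (hm_zero H)}"

definition orth_complemented :: "('m, 'a) hilb_mod \<Rightarrow> 'm set \<Rightarrow> bool" where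
  "orth_complemented H M \<longleftrightarrow> (\<forall>x. \<exists>m\<in>M. \<exists>k\<in>orth H M. x = hm_add H m k)"

definition orth_proj :: "('m, 'a) hilb_mod \<Rightarrow> 'm set \<Rightarrow> 'm \<Rightarrow> 'm" where
  "orth_proj H M x = (THE m. m \<in> M \<and> hm_minus H x m \<in> orth H M)"

definition H1 where "H1 H P Q = range P \<inter> range Q"
definition H2 where "H2 H P Q = range P \<inter> ker_op H Q"
definition H3 where "H3 H P Q = ker_op H P \<inter> range Q"
definition H4 where "H4 H P Q = ker_op H P \<inter> ker_op H Q"
definition H5 where "H5 A H P Q = hm_closure A H (range (P \<circ> Q \<circ> (\<lambda>x. hm_minus H x (P x))))"
definition H6 where "H6 A H P Q = hm_closure A H (range ((\<lambda>x. hm_minus H x (P x)) \<circ> Q \<circ> P))"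

definition harmonious :: "'a cstar_alg \<Rightarrow> ('m, 'a) hilb_mod \<Rightarrow> ('m \<Rightarrow> 'm) \<Rightarrow> ('m \<Rightarrow> 'm) \<Rightarrow> bool" where
  "harmonious A H P Q \<longleftrightarrow> quasi_projection_pair H P Q \<and>
     orth_complemented H (H5 A H P Q) \<and> orth_complemented H (H6 A H P Q)"

type_synonym 'm six = "'m \<times> 'm \<times> 'm \<times> 'm \<times> 'm \<times> 'm"

definition dsum_carrier :: "'a cstar_alg \<Rightarrow> ('m, 'a) hilb_mod \<Rightarrow> ('m \<Rightarrow> 'm) \<Rightarrow> ('m \<Rightarrow> 'm) \<Rightarrow> 'm six set" where
  "dsum_carrier A H P Q = H1 H P Q \<times> H2 H P Q \<times> H3 H P Q \<times> H4 H P Q \<times> H5 A H P Q \<times> H6 A H P Q"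

definition U_PQ :: "'a cstar_alg \<Rightarrow> ('m, 'a) hilb_mod \<Rightarrow> ('m \<Rightarrow> 'm) \<Rightarrow> ('m \<Rightarrow> 'm) \<Rightarrow> 'm \<Rightarrow> 'm six" where
  "U_PQ A H P Q x = (orth_proj H (H1 H P Q) x, orth_proj H (H2 H P Q) x, orth_proj H (H3 H P Q) x,
                     orth_proj H (H4 H P Q) x, orth_proj H (H5 A H P Q) x, orth_proj H (H6 A H P Q) x)"

definition U_PQ_adj :: "('m, 'a) hilb_mod \<Rightarrow> 'm six \<Rightarrow> 'm" where
  "U_PQ_adj H y = (case y of (y1, y2, y3, y4, y5, y6) \<Rightarrow>
     hm_add H y1 (hm_add H y2 (hm_add H y3 (hm_add H y4 (hm_add H y5 y6)))))"

definition adjointable_on :: "('m, 'a) hilb_mod \<Rightarrow> 'm set \<Rightarrow> ('m \<Rightarrow> 'm) \<Rightarrow> bool" where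
  "adjointable_on H K T \<longleftrightarrow> T ` K \<subseteq> K \<and>
     (\<exists>S. S ` K \<subseteq> K \<and> (\<forall>x\<in>K. \<forall>y\<in>K. hm_inner H (T x) y = hm_inner H x (S y)))"

definition selfadjoint_on :: "('m, 'a) hilb_mod \<Rightarrow> 'm set \<Rightarrow> ('m \<Rightarrow> 'm) \<Rightarrow> bool" where
  "selfadjoint_on H K T \<longleftrightarrow> T ` K \<subseteq> K \<and> (\<forall>x\<in>K. \<forall>y\<in>K. hm_inner H (T x) y = hm_inner H x (T y))"

definition positive_on :: "('m, 'a) hilb_mod \<Rightarrow> 'm set \<Rightarrow> ('m \<Rightarrow> 'm) \<Rightarrow> bool" where
  "positive_on H K T \<longleftrightarrow> T ` K \<subseteq> K \<and>
     (\<exists>B Bs. B ` K \<subseteq> K \<and> Bs ` K \<subseteq> K \<and>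
        (\<forall>x\<in>K. \<forall>y\<in>K. hm_inner H (B x) y = hm_inner H x (Bs y)) \<and>
        (\<forall>x\<in>K. T x = Bs (B x)))"

definition sq_minus :: "('m, 'a) hilb_mod \<Rightarrow> ('m \<Rightarrow> 'm) \<Rightarrow> ('m \<Rightarrow> 'm)" where
  "sq_minus H T = (\<lambda>x. hm_minus H (T (T x)) (T x))"

text \<open>ell(A) = (A^2 - A)^{1/2} in L(K): the positive square root, normalised to 0 off K.\<close>
definition ell :: "('m, 'a) hilb_mod \<Rightarrow> 'm set \<Rightarrow> ('m \<Rightarrow> 'm) \<Rightarrow> ('m \<Rightarrow> 'm)" where
  "ell H K T = (THE S. (\<forall>x. x \<notin> K \<longrightarrow> S x = hm_zero H) \<and> positive_on H K S \<and>
                       (\<forall>x\<in>K. S (S x) = sq_minus H T x))"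

definition unitary_between :: "('m, 'a) hilb_mod \<Rightarrow> 'm set \<Rightarrow> 'm set \<Rightarrow> ('m \<Rightarrow> 'm) \<Rightarrow> ('m \<Rightarrow> 'm) \<Rightarrow> bool" where
  "unitary_between H K L U V \<longleftrightarrow> U ` K \<subseteq> L \<and> V ` L \<subseteq> K \<and>
     (\<forall>x\<in>K. \<forall>y\<in>L. hm_inner H (U x) y = hm_inner H x (V y)) \<and>
     (\<forall>x\<in>K. V (U x) = x) \<and> (\<forall>y\<in>L. U (V y) = y)"

text \<open>The operator Q-hat on H5 + H6 determined by A, ell(A), U and its adjoint V.\<close>
definition Qhat :: "('m, 'a) hilb_mod \<Rightarrow> 'm set \<Rightarrow> ('m \<Rightarrow> 'm) \<Rightarrow> ('m \<Rightarrow> 'm) \<Rightarrow> ('m \<Rightarrow> 'm)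
                    \<Rightarrow> 'm \<times> 'm \<Rightarrow> 'm \<times> 'm" where
  "Qhat H K A U V = (\<lambda>(y5, y6).
     (hm_minus H (A y5) (ell H K A (V y6)),
      hm_add H (U (ell H K A y5)) (U (hm_minus H (V y6) (A (V y6))))))"

end

theory Submission
  imports Defs
begin

text \<open>
  Write \<open>b = PQ(1-P)\<close>, \<open>c = (1-P)QP\<close>, \<open>a = PQP\<close>, \<open>d = (1-P)Q(1-P)\<close>. The quasi-projection identity
  says that \<open>a\<close> and \<open>d\<close> are self-adjoint and \<open>b* = -c\<close>, and \<open>Q\<^sup>2 = Q\<close> gives \<open>a\<^sup>2 - a = b b* = c* c\<close> and
  \<open>d c = c (1 - a)\<close>. Hence \<open>c = U (a\<^sup>2 - a)\<^bsup>1/2\<^esup>\<close> on \<open>H5\<close> with an isometry \<open>U\<close> that extends to a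
  unitary \<open>H5 \<rightarrow> H6\<close> because the ranges are dense, and taking adjoints and cancelling the square root
  gives the other two blocks.

  The positivity theory of \<open>C*\<close>-algebras behind this is derived in the algebra of adjointable
  operators of a module for which the Cauchy--Schwarz inequality is known. An algebra acting on itself
  by multiplication is such a module, and from the order obtained there the Cauchy--Schwarz inequality
  follows for every Hilbert module over it.
\<close>

text \<open>As \<open>ca_pos\<close> only asserts the form \<open>b* b\<close>, even the positivity
  of a sum is a theorem. The triangle inequality for \<open>hm_norm\<close> rests on
  Cauchy--Schwarz, which rests on the order of the algebra. The locale \<open>hilb_module_cs\<close>
  isolates this one inequality, so that the same operator theory serves the algebra acting on itself
  and then \<open>H\<close>. Neither spectrum nor functional calculus enters. Positivity of a
  self-adjoint \<open>T\<close> is tested by norms: the norm of \<open>r - T\<close> is at most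
  \<open>r\<close> for some \<open>r > 0\<close>. Roots come from an iteration, and the bicommutant
  property stands in for being a limit of polynomials in \<open>T\<close>. Adjointability is purely
  algebraic, so linearity and boundedness have to be derived before limits can be taken. Since
  \<open>ell\<close> is a definite description over operators on \<open>H5\<close>, the positive
  root must be shown unique among operators that live on \<open>H5\<close> only. Composing with the
  projection onto \<open>H5\<close>, which exists by harmony, moves them to
  \<open>H\<close>.\<close>

locale hilb_module =
  fixes A :: "'a cstar_alg" and H :: "('m, 'a) hilb_mod"
  assumes hilbert_module: "hilbert_module A H"
begin

abbreviation vadd (infixl "\<oplus>" 65) where "x \<oplus> y \<equiv> hm_add H x y"
abbreviation vsub (infixl "\<ominus>" 65) where "x \<ominus> y \<equiv> hm_minus H x y"
abbreviation vsm (infixr "\<cdot>" 75) where "c \<cdot> x \<equiv> hm_smul H c x"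
abbreviation vz ("\<zero>") where "\<zero> \<equiv> hm_zero H"
abbreviation ip where "ip \<equiv> hm_inner H"
abbreviation nm where "nm \<equiv> hm_norm A H"
abbreviation aadd (infixl "\<boxplus>" 65) where "x \<boxplus> y \<equiv> ca_add A x y"
abbreviation asub (infixl "\<boxminus>" 65) where "x \<boxminus> y \<equiv> vminus (ca_add A) (ca_smul A) x y"
abbreviation amul (infixl "\<boxtimes>" 70) where "x \<boxtimes> y \<equiv> ca_mult A x y"
abbreviation star where "star \<equiv> ca_star A"
abbreviation na where "na \<equiv> ca_norm A"

section \<open>Calculus of the module and its inner product\<close>

lemma cstar: "cstar_algebra A"
  using hilbert_module unfolding hilbert_module_def by (elim conjE)

lemma vs_H: "complex_vs (hm_add H) (hm_zero H) (hm_smul H)"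
  using hilbert_module unfolding hilbert_module_def by (elim conjE)

lemma banach_A: "complex_banach (ca_add A) (ca_zero A) (ca_smul A) (ca_norm A)"
  using cstar unfolding cstar_algebra_def by (elim conjE)

lemma vs_A: "complex_vs (ca_add A) (ca_zero A) (ca_smul A)"
  using banach_A by (simp add: complex_banach_def)

text \<open>Makes the library's rewriting of sums and differences available for the record
  operations. Scaling by -1 is the negation, so \<open>vec.add_uminus_conv_diff\<close> folds
  \<open>x \<oplus> (-1) \<cdot> y\<close> into a difference; proofs that unfold a difference have
  to remove this rule from the simpset.\<close>

sublocale vec: ab_group_add "hm_add H" "hm_zero H" "hm_minus H" "hm_smul H (-1)"
proof -
  note [simp] = hm_minus_def vminus_def
  show "class.ab_group_add (hm_add H) (hm_zero H) (hm_minus H) (hm_smul H (-1))"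
  proof
    fix a b c
    show "hm_add H (hm_add H a b) c = hm_add H a (hm_add H b c)"
      using vs_H unfolding complex_vs_def by blast
    show "hm_add H a b = hm_add H b a"
      using vs_H unfolding complex_vs_def by blast
    show "hm_add H (hm_zero H) a = a"
      using vs_H unfolding complex_vs_def by metis
    show "hm_add H (hm_smul H (-1) a) a = hm_zero H"
      using vs_H unfolding complex_vs_def by metis
    show "hm_minus H a b = hm_add H a (hm_smul H (-1) b)"
      by simp
  qed
qed

sublocale alg: ab_group_add "ca_add A" "ca_zero A" "vminus (ca_add A) (ca_smul A)" "ca_smul A (-1)"
proof -
  note [simp] = vminus_def
  show "class.ab_group_add (ca_add A) (ca_zero A) (vminus (ca_add A) (ca_smul A)) (ca_smul A (-1))"
  proof
    fix a b c
    show "ca_add A (ca_add A a b) c = ca_add A a (ca_add A b c)"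
      using vs_A unfolding complex_vs_def by blast
    show "ca_add A a b = ca_add A b a"
      using vs_A unfolding complex_vs_def by blast
    show "ca_add A (ca_zero A) a = a"
      using vs_A unfolding complex_vs_def by metis
    show "ca_add A (ca_smul A (-1) a) a = ca_zero A"
      using vs_A unfolding complex_vs_def by metis
    show "vminus (ca_add A) (ca_smul A) a b = ca_add A a (ca_smul A (-1) b)"
      by simp
  qed
qed

lemma vec_add_diff [simp]: "x \<oplus> (y \<ominus> x) = y"
  by (simp add: vec.add_diff_eq)

lemma smul_one [simp]: "1 \<cdot> x = x"
  and smul_smul [simp]: "a \<cdot> b \<cdot> x = (a * b) \<cdot> x"
  and smul_add_right: "a \<cdot> (x \<oplus> y) = a \<cdot> x \<oplus> a \<cdot> y"
  and smul_add_left: "(a + b) \<cdot> x = a \<cdot> x \<oplus> b \<cdot> x"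
  using vs_H unfolding complex_vs_def by blast+

lemma smul_zero_left [simp]: "0 \<cdot> x = \<zero>"
  using smul_add_left[of 0 0 x] by simp

lemma smul_zero_right [simp]: "c \<cdot> \<zero> = \<zero>"
  using smul_add_right[of c \<zero> \<zero>] by simp

lemma smul_diff_right: "c \<cdot> (x \<ominus> y) = c \<cdot> x \<ominus> c \<cdot> y"
  unfolding hm_minus_def vminus_def by (simp add: smul_add_right del: vec.add_uminus_conv_diff)

lemma smul_two: "2 \<cdot> x = x \<oplus> x"
  using smul_add_left[of 1 1 x] by simp

lemma norm_A:
  "0 \<le> na a" "na a = 0 \<longleftrightarrow> a = ca_zero A" "na (ca_smul A c a) = cmod c * na a"
  "na (a \<boxplus> b) \<le> na a + na b"
  using banach_A by (auto simp: complex_banach_def)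

lemma asmul_one [simp]: "ca_smul A 1 a = a"
  and asmul_asmul [simp]: "ca_smul A c (ca_smul A d a) = ca_smul A (c * d) a"
  and asmul_add_right: "ca_smul A c (a \<boxplus> b) = ca_smul A c a \<boxplus> ca_smul A c b"
  using vs_A unfolding complex_vs_def by blast+

lemma asmul_diff_right: "ca_smul A c (a \<boxminus> b) = ca_smul A c a \<boxminus> ca_smul A c b"
  unfolding vminus_def by (simp add: asmul_add_right del: alg.add_uminus_conv_diff)

lemma mult_A:
  "(a \<boxtimes> b) \<boxtimes> c = a \<boxtimes> (b \<boxtimes> c)"
  "(a \<boxplus> b) \<boxtimes> c = a \<boxtimes> c \<boxplus> b \<boxtimes> c"
  "a \<boxtimes> (b \<boxplus> c) = a \<boxtimes> b \<boxplus> a \<boxtimes> c"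
  "ca_smul A s a \<boxtimes> b = ca_smul A s (a \<boxtimes> b)"
  "a \<boxtimes> ca_smul A s b = ca_smul A s (a \<boxtimes> b)"
  "na (a \<boxtimes> b) \<le> na a * na b"
  using cstar unfolding cstar_algebra_def by (blast | elim conjE; metis)+

lemma star_A [simp]:
  "star (star a) = a" "star (a \<boxplus> b) = star a \<boxplus> star b"
  "star (ca_smul A c a) = ca_smul A (cnj c) (star a)"
  "star (a \<boxtimes> b) = star b \<boxtimes> star a"
  "na (star a \<boxtimes> a) = (na a)\<^sup>2"
  using cstar unfolding cstar_algebra_def by blast+

lemma star_diff [simp]: "star (a \<boxminus> b) = star a \<boxminus> star b"
  unfolding vminus_def by (simp del: alg.add_uminus_conv_diff)

lemma star_zero [simp]: "star (ca_zero A) = ca_zero A"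
  using star_A(2)[of "ca_zero A" "ca_zero A"] by simp

lemma mult_diff_A:
  "(a \<boxminus> b) \<boxtimes> c = a \<boxtimes> c \<boxminus> b \<boxtimes> c" "a \<boxtimes> (b \<boxminus> c) = a \<boxtimes> b \<boxminus> a \<boxtimes> c"
  unfolding vminus_def by (simp_all add: mult_A del: alg.add_uminus_conv_diff)

text \<open>By the \<open>C*\<close>-identity \<open>(na b)\<^sup>2\<close> is at most
  \<open>na (star b) * na b\<close>. Cancelling \<open>na b\<close> gives one inequality, and
  replacing \<open>b\<close> by its star the other.\<close>

lemma na_star [simp]: "na (star a) = na a"
proof -
  have le: "na b \<le> na (star b)" for b
  proof (cases "na b = 0")
    case False
    have "(na b)\<^sup>2 \<le> na (star b) * na b"
      using mult_A(6)[of "star b" b] by simp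
    then show ?thesis
      using False norm_A(1)[of b] by (simp add: power2_eq_square)
  qed (simp add: norm_A)
  show ?thesis
    using le[of a] le[of "star a"] by simp
qed

lemma ip_add_right: "ip x (y \<oplus> w) = ip x y \<boxplus> ip x w"
  and ip_smul_right: "ip x (c \<cdot> y) = ca_smul A c (ip x y)"
  and ip_star: "star (ip x y) = ip y x"
  and ip_self_zero: "ip x x = ca_zero A \<Longrightarrow> x = \<zero>"
  and ip_pos: "ca_pos A (ip x x)"
  and ip_act_right: "ip x (hm_act H y a) = ip x y \<boxtimes> a"
  and complete_H: "(\<And>e. e > 0 \<Longrightarrow> \<exists>N. \<forall>m\<ge>N. \<forall>n\<ge>N. nm (X m \<ominus> X n) < e)
        \<Longrightarrow> \<exists>L. (\<lambda>n. nm (X n \<ominus> L)) \<longlonglongrightarrow> 0"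
  using hilbert_module unfolding hilbert_module_def by (blast | elim conjE; metis)+

lemma ip_add_left: "ip (x \<oplus> y) w = ip x w \<boxplus> ip y w"
  by (metis ip_add_right ip_star star_A(2))

lemma ip_smul_left: "ip (c \<cdot> x) w = ca_smul A (cnj c) (ip x w)"
  by (metis ip_smul_right ip_star star_A(3))

lemma ip_act_left: "ip (hm_act H x a) w = star a \<boxtimes> ip x w"
  by (metis ip_act_right ip_star star_A(4))

lemma ip_diff_right: "ip x (y \<ominus> w) = ip x y \<boxminus> ip x w"
  unfolding hm_minus_def vminus_def
  by (simp add: ip_add_right ip_smul_right del: vec.add_uminus_conv_diff alg.add_uminus_conv_diff)

lemma ip_diff_left: "ip (x \<ominus> y) w = ip x w \<boxminus> ip y w"
  by (metis ip_diff_right ip_star star_diff)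

lemma ip_zero_right [simp]: "ip x \<zero> = ca_zero A"
  using ip_add_right[of x \<zero> \<zero>] by simp

lemma ip_zero_left [simp]: "ip \<zero> x = ca_zero A"
  using ip_add_left[of \<zero> \<zero> x] by simp

lemmas ip_simps = ip_add_left ip_add_right ip_diff_left ip_diff_right ip_smul_left ip_smul_right

lemma ip_eqI:
  assumes "\<And>x. ip x y = ip x w" shows "y = w"
proof -
  have "ip (y \<ominus> w) (y \<ominus> w) = ca_zero A"
    using assms[of "y \<ominus> w"] by (simp add: ip_diff_right)
  then show ?thesis
    using ip_self_zero by fastforce
qed

lemma nm_nonneg [simp]: "0 \<le> nm x"
  and nm_sq: "(nm x)\<^sup>2 = na (ip x x)"
  by (simp_all add: hm_norm_def norm_A)

lemma nm_eq_0 [simp]: "nm x = 0 \<longleftrightarrow> x = \<zero>"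
  using ip_self_zero[of x] by (auto simp: hm_norm_def norm_A)

lemma nm_zero [simp]: "nm \<zero> = 0"
  by simp

lemma nm_smul: "nm (c \<cdot> x) = cmod c * nm x"
  by (simp add: hm_norm_def ip_simps norm_A real_sqrt_mult norm_mult flip: mult.assoc)

lemma nm_uminus [simp]: "nm ((-1) \<cdot> x) = nm x"
  by (simp add: nm_smul)

lemma nm_minus_commute: "nm (x \<ominus> y) = nm (y \<ominus> x)"
  by (metis nm_uminus vec.minus_diff_eq)

lemma nm_smul_of_real: "r \<ge> 0 \<Longrightarrow> nm (of_real r \<cdot> x) = r * nm x"
  by (simp add: nm_smul)

section \<open>Adjoint pairs of operators\<close>

text \<open>A relation between two operators, so that an explicit formula for the adjoint can be
  carried along; \<open>adj\<close> is a choice and offers no formula.\<close>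

definition adjp where "adjp T S \<longleftrightarrow> (\<forall>x y. ip (T x) y = ip x (S y))"

abbreviation sa where "sa T \<equiv> adjp T T"

lemma adjpD: "adjp T S \<Longrightarrow> ip (T x) y = ip x (S y)"
  by (simp add: adjp_def)

lemma adjp_sym: "adjp T S \<Longrightarrow> adjp S T"
  unfolding adjp_def by (metis ip_star)

lemma adjp_comp: "adjp T S \<Longrightarrow> adjp T' S' \<Longrightarrow> adjp (\<lambda>x. T (T' x)) (\<lambda>x. S' (S x))"
  unfolding adjp_def by simp

lemma adjp_add: "adjp T S \<Longrightarrow> adjp T' S' \<Longrightarrow> adjp (\<lambda>x. T x \<oplus> T' x) (\<lambda>x. S x \<oplus> S' x)"
  and adjp_diff: "adjp T S \<Longrightarrow> adjp T' S' \<Longrightarrow> adjp (\<lambda>x. T x \<ominus> T' x) (\<lambda>x. S x \<ominus> S' x)"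
  and adjp_smul: "adjp T S \<Longrightarrow> adjp (\<lambda>x. c \<cdot> T x) (\<lambda>x. cnj c \<cdot> S x)"
  and adjp_id: "adjp (\<lambda>x. x) (\<lambda>x. x)"
  unfolding adjp_def by (simp_all add: ip_simps)

lemma sa_smul: "sa T \<Longrightarrow> sa (\<lambda>x. of_real r \<cdot> T x)"
  using adjp_smul[of T T "of_real r"] by simp

lemma sa_smul_id: "sa (\<lambda>x. of_real r \<cdot> x)"
  using sa_smul[OF adjp_id] .

lemma adjp_unique: "adjp T S \<Longrightarrow> adjp T S' \<Longrightarrow> S = S'"
  unfolding adjp_def by (metis ext ip_eqI)

text \<open>Linearity is not part of \<open>adjointable\<close>. Testing against an arbitrary vector
  moves \<open>T\<close> to the other side as \<open>S\<close>, where linearity of the inner product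
  in its second argument applies.\<close>

lemma adjp_linear:
  assumes "adjp T S"
  shows "T (x \<oplus> y) = T x \<oplus> T y" "T (x \<ominus> y) = T x \<ominus> T y" "T (c \<cdot> x) = c \<cdot> T x" "T \<zero> = \<zero>"
proof -
  note [simp] = adjpD[OF adjp_sym[OF assms], symmetric]
  show "T (x \<oplus> y) = T x \<oplus> T y" "T (x \<ominus> y) = T x \<ominus> T y" "T (c \<cdot> x) = c \<cdot> T x" "T \<zero> = \<zero>"
    by (rule ip_eqI, simp add: ip_simps)+
qed

lemma sa_comp:
  assumes "sa T" "sa S" "\<And>x. T (S x) = S (T x)" shows "sa (\<lambda>x. T (S x))"
  using adjp_comp[OF assms(1,2)] assms(3) by simp

lemma sa_square_eq_0:
  assumes "sa T" "T (T x) = \<zero>" shows "T x = \<zero>"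
  using adjpD[OF assms(1), of x "T x"] assms(2) by (auto intro: ip_self_zero)

end

subsection \<open>Boundedness of adjointable operators\<close>

locale hilb_module_cs = hilb_module +
  assumes cauchy_schwarz: "na (ip x y) \<le> nm x * nm y"
begin

lemma nm_triangle: "nm (x \<oplus> y) \<le> nm x + nm y"
proof -
  have "(nm (x \<oplus> y))\<^sup>2 = na ((ip x x \<boxplus> ip x y) \<boxplus> (ip y x \<boxplus> ip y y))"
    by (simp add: nm_sq ip_simps alg.add_ac)
  also have "\<dots> \<le> na (ip x x) + na (ip x y) + (na (ip y x) + na (ip y y))"
    by (meson add_mono norm_A(4) order_trans)
  also have "\<dots> \<le> (nm x + nm y)\<^sup>2"
    using cauchy_schwarz[of x y] cauchy_schwarz[of y x]
    by (simp add: power2_sum algebra_simps flip: nm_sq)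
  finally show ?thesis
    by (rule power2_le_imp_le) simp
qed

lemma nm_triangle_diff: "nm (x \<ominus> y) \<le> nm x + nm y"
  using nm_triangle[of x "(-1) \<cdot> y"] by simp

lemma nm_diff_le: "nm (x \<ominus> w) \<le> nm (x \<ominus> y) + nm (y \<ominus> w)"
  using nm_triangle[of "x \<ominus> y" "y \<ominus> w"] by (simp add: vec.add_diff_eq)

lemma nm_le_add_diff: "nm x \<le> nm y + nm (x \<ominus> y)"
  using nm_triangle[of y "x \<ominus> y"] by (simp add: vec.add_diff_eq)

lemma metric_space_H: "Metric_space UNIV (\<lambda>x y. nm (x \<ominus> y))"
proof
  fix x y w :: 'b
  show "0 \<le> nm (x \<ominus> y)" by simp
  show "nm (x \<ominus> y) = nm (y \<ominus> x)" by (rule nm_minus_commute)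
  show "nm (x \<ominus> y) = 0 \<longleftrightarrow> x = y" by simp
  show "nm (x \<ominus> w) \<le> nm (x \<ominus> y) + nm (y \<ominus> w)" by (rule nm_diff_le)
qed

text \<open>The Baire category theorem for the norm metric, with closedness phrased by sequences
  because the sets it is meant for are sublevel sets.\<close>

lemma baire:
  fixes E :: "nat \<Rightarrow> 'b set"
  assumes closed: "\<And>n X l. (\<And>k. X k \<in> E n) \<Longrightarrow> (\<lambda>k. nm (X k \<ominus> l)) \<longlonglongrightarrow> 0 \<Longrightarrow> l \<in> E n"
    and cover: "\<And>x. \<exists>n. x \<in> E n"
  shows "\<exists>n x0 r. r > 0 \<and> (\<forall>x. nm (x0 \<ominus> x) < r \<longrightarrow> x \<in> E n)"
proof -
  note lim = Metric_space.limit_metric_sequentially[OF metric_space_H]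
  let ?top = "Metric_space.mtopology UNIV (\<lambda>x y. nm (x \<ominus> y))"
  have lim_iff: "limitin ?top X l sequentially \<longleftrightarrow> (\<lambda>k. nm (X k \<ominus> l)) \<longlonglongrightarrow> 0" for X l
    unfolding lim LIMSEQ_iff by simp
  have complete: "Metric_space.mcomplete UNIV (\<lambda>x y. nm (x \<ominus> y))"
    unfolding Metric_space.mcomplete_def[OF metric_space_H] Metric_space.MCauchy_def[OF metric_space_H]
      lim_iff
  proof (intro allI impI)
    fix X :: "nat \<Rightarrow> 'b"
    assume X: "range X \<subseteq> UNIV \<and> (\<forall>\<epsilon>>0. \<exists>N. \<forall>n n'. N \<le> n \<longrightarrow> N \<le> n' \<longrightarrow> nm (X n \<ominus> X n') < \<epsilon>)"
    show "\<exists>L. (\<lambda>n. nm (X n \<ominus> L)) \<longlonglongrightarrow> 0"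
    proof (rule complete_H)
      fix e :: real assume "e > 0"
      then obtain N where "\<forall>n n'. N \<le> n \<longrightarrow> N \<le> n' \<longrightarrow> nm (X n \<ominus> X n') < e"
        using X by presburger
      then show "\<exists>N. \<forall>m\<ge>N. \<forall>n\<ge>N. nm (X m \<ominus> X n) < e"
        by (intro exI[of _ N]) simp
    qed
  qed
  have cl: "closedin ?top (E n)" for n
    unfolding Metric_space.metric_closedin_iff_sequentially_closed[OF metric_space_H] lim_iff
    using closed[of _ n] by (auto simp: image_subset_iff)
  have "?top interior_of \<Union> (range E) \<noteq> {}"
  proof -
    have "\<Union> (range E) = topspace ?top"
      using cover by (auto simp: Metric_space.topspace_mtopology[OF metric_space_H])
    then show ?thesis
      using interior_of_topspace[of ?top] by (simp add: Metric_space.topspace_mtopology[OF metric_space_H])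
  qed
  then have "\<not> (\<forall>n. ?top interior_of E n = {})"
    using Metric_space.metric_Baire_category_alt[OF metric_space_H complete, of "range E"] cl by auto
  then obtain n where "?top interior_of E n \<noteq> {}"
    by blast
  then obtain x0 where "x0 \<in> ?top interior_of E n"
    by blast
  then obtain r where "r > 0" "Metric_space.mball UNIV (\<lambda>x y. nm (x \<ominus> y)) x0 r \<subseteq> E n"
    unfolding Metric_space.in_interior_of_mball[OF metric_space_H] by blast
  then show ?thesis
    unfolding Metric_space.mball_def[OF metric_space_H] by blast
qed

text \<open>Hellinger--Toeplitz: the sublevel sets of \<open>x \<mapsto> nm (T x)\<close> are closed because
  \<open>nm (T x)\<close> is a supremum of the continuous functions \<open>x \<mapsto> na (ip (S y) x)\<close>.\<close>
lemma adjp_bounded: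
  assumes "adjp T S"
  shows "\<exists>C>0. \<forall>x. nm (T x) \<le> C * nm x"
proof -
  define E where "E n = {x. nm (T x) \<le> real n}" for n
  have E_iff: "x \<in> E n \<longleftrightarrow> (\<forall>y. nm y \<le> 1 \<longrightarrow> na (ip (S y) x) \<le> real n)" for x n
  proof
    assume "x \<in> E n"
    show "\<forall>y. nm y \<le> 1 \<longrightarrow> na (ip (S y) x) \<le> real n"
    proof (intro allI impI)
      fix y assume "nm y \<le> 1"
      have "na (ip (S y) x) = na (ip y (T x))"
        using adjpD[OF adjp_sym[OF assms]] by simp
      also have "\<dots> \<le> nm y * nm (T x)"
        by (rule cauchy_schwarz)
      also have "\<dots> \<le> 1 * real n"
        using \<open>nm y \<le> 1\<close> \<open>x \<in> E n\<close> unfolding E_def by (intro mult_mono) auto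
      finally show "na (ip (S y) x) \<le> real n" by simp
    qed
  next
    assume R: "\<forall>y. nm y \<le> 1 \<longrightarrow> na (ip (S y) x) \<le> real n"
    show "x \<in> E n"
    proof (cases "T x = \<zero>")
      case False
      \<comment> \<open>The normalised image is the test vector at which the supremum over the unit
        ball is attained.\<close>
      define y where "y = of_real (inverse (nm (T x))) \<cdot> T x"
      have pos: "nm (T x) > 0"
        using False nm_nonneg[of "T x"] by (simp add: less_le del: nm_nonneg)
      have "nm y = 1"
        using pos False by (simp add: y_def nm_smul_of_real del: of_real_inverse)
      then have "na (ip y (T x)) \<le> real n"
        using R adjpD[OF adjp_sym[OF assms]] by simp
      moreover have "na (ip y (T x)) = nm (T x)"
        using pos False by (simp add: y_def ip_simps norm_A power2_eq_square norm_inverse flip: nm_sq)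
      ultimately show ?thesis
        by (simp add: E_def)
    qed (simp add: E_def)
  qed
  have "\<exists>n x0 r. r > 0 \<and> (\<forall>x. nm (x0 \<ominus> x) < r \<longrightarrow> x \<in> E n)"
  proof (rule baire)
    fix n X l assume X: "\<And>k. X k \<in> E n" "(\<lambda>k. nm (X k \<ominus> l)) \<longlonglongrightarrow> 0"
    show "l \<in> E n"
      unfolding E_iff
    proof (intro allI impI)
      fix y assume y: "nm y \<le> 1"
      show "na (ip (S y) l) \<le> real n"
      proof (rule field_le_epsilon)
        fix e :: real assume "e > 0"
        define \<delta> where "\<delta> = e / (nm (S y) + 1)"
        have "\<delta> > 0"
          using \<open>e > 0\<close> nm_nonneg[of "S y"] by (simp add: \<delta>_def add_nonneg_pos)
        then obtain m where m: "nm (X m \<ominus> l) < \<delta>"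
          using X(2) unfolding LIMSEQ_iff by fastforce
        have "ip (S y) l = ip (S y) (X m) \<boxplus> ip (S y) (l \<ominus> X m)"
          by (simp flip: ip_add_right)
        then have "na (ip (S y) l) \<le> na (ip (S y) (X m)) + na (ip (S y) (l \<ominus> X m))"
          using norm_A(4) by simp
        moreover have "na (ip (S y) (X m)) \<le> real n"
          using X(1) y E_iff by blast
        moreover have "na (ip (S y) (l \<ominus> X m)) \<le> nm (S y) * \<delta>"
          using cauchy_schwarz[of "S y" "l \<ominus> X m"] m
          by (smt (verit) mult_left_mono nm_minus_commute nm_nonneg)
        moreover have "nm (S y) * \<delta> \<le> e"
          using \<open>e > 0\<close> by (simp add: \<delta>_def pos_divide_le_eq add_pos_nonneg algebra_simps)
        ultimately show "na (ip (S y) l) \<le> real n + e"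
          by simp
      qed
    qed
  next
    show "\<exists>n. x \<in> E n" for x
      using real_arch_simple by (auto simp: E_def)
  qed
  then obtain n x0 r where r: "r > 0" "\<And>x. nm (x0 \<ominus> x) < r \<Longrightarrow> x \<in> E n"
    by blast
  \<comment> \<open>A step of length \<open>r / 2\<close> from \<open>x0\<close> stays in the ball,
    and the two values of \<open>T\<close> differ by at most \<open>2 * n\<close>; rescaling gives
    the factor \<open>4 * n / r\<close>. The added 1 keeps \<open>C\<close> positive when
    \<open>n = 0\<close>.\<close>
  define C where "C = 4 * (real n + 1) / r"
  have "nm (T x) \<le> C * nm x" for x
  proof (cases "x = \<zero>")
    case True
    then show ?thesis by (simp add: adjp_linear[OF assms])
  next
    case False
    then have pos: "nm x > 0"
      using nm_nonneg[of x] by (simp add: less_le del: nm_nonneg)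
    define c where "c = r / (2 * nm x)"
    have c: "c > 0" using pos r by (simp add: c_def)
    define u where "u = x0 \<oplus> of_real c \<cdot> x"
    have "nm (u \<ominus> x0) = r / 2"
      using pos c False by (simp add: u_def nm_smul_of_real) (simp add: c_def)
    then have "u \<in> E n" "x0 \<in> E n"
      using r nm_minus_commute[of u x0] by auto
    then have "nm (T u \<ominus> T x0) \<le> 2 * real n"
      using nm_triangle_diff[of "T u" "T x0"] by (simp add: E_def)
    moreover have "T u \<ominus> T x0 = of_real c \<cdot> T x"
      by (simp add: u_def adjp_linear[OF assms])
    ultimately have "c * nm (T x) \<le> 2 * real n"
      using c by (simp add: nm_smul_of_real)
    then have "nm (T x) \<le> 2 * real n / c"
      using c by (simp add: field_simps)
    also have "\<dots> \<le> C * nm x"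
      using pos r False by (simp add: c_def C_def field_simps)
    finally show ?thesis .
  qed
  moreover have "C > 0" using r by (simp add: C_def)
  ultimately show ?thesis by blast
qed

end

subsection \<open>Square roots\<close>

primrec visser_bound :: "nat \<Rightarrow> real" where
  "visser_bound 0 = 0"
| "visser_bound (Suc n) = (1 + (visser_bound n)\<^sup>2) / 2"

lemma visser_bound_nonneg: "0 \<le> visser_bound n"
  by (induction n) auto

lemma visser_bound_le_1: "visser_bound n \<le> 1"
  by (induction n) (auto simp: power_le_one visser_bound_nonneg)

lemma visser_bound_mono: "mono visser_bound"
proof (rule incseq_SucI)
  show "visser_bound n \<le> visser_bound (Suc n)" for n
    using zero_le_power2[of "visser_bound n - 1"] by (simp add: power2_diff)
qed

lemma visser_bound_Cauchy: "Cauchy visser_bound"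
  using incseq_convergent[OF visser_bound_mono, of 1] visser_bound_le_1
  by (metis LIMSEQ_imp_Cauchy)

context hilb_module_cs
begin

lemma eq_by_limit:
  assumes "\<And>n. nm (u \<ominus> w) \<le> f n" "f \<longlonglongrightarrow> 0" shows "u = w"
  using LIMSEQ_le_const[OF assms(2)] assms(1)
  by (metis nm_eq_0 nm_nonneg order_antisym vec.right_minus_eq)

lemma eq_by_limit_A:
  assumes "\<And>n. na (a \<boxminus> b) \<le> f n" "f \<longlonglongrightarrow> 0" shows "a = b"
  using LIMSEQ_le_const[OF assms(2)] assms(1)
  by (metis norm_A(1,2) order_antisym alg.right_minus_eq)

lemma nm_limit_le:
  assumes "\<And>n. nm (X n) \<le> c" "(\<lambda>n. nm (X n \<ominus> l)) \<longlonglongrightarrow> 0" shows "nm l \<le> c"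
proof (rule LIMSEQ_le_const)
  show "(\<lambda>n. c + nm (X n \<ominus> l)) \<longlonglongrightarrow> c"
    using tendsto_add[OF tendsto_const assms(2), of c] by simp
  show "\<exists>N. \<forall>n\<ge>N. nm l \<le> c + nm (X n \<ominus> l)"
    using assms(1) nm_le_add_diff nm_minus_commute by (metis add_mono order_refl order_trans)
qed

primrec visser :: "('b \<Rightarrow> 'b) \<Rightarrow> nat \<Rightarrow> 'b \<Rightarrow> 'b" where
  "visser X 0 = (\<lambda>x. \<zero>)"
| "visser X (Suc n) = (\<lambda>x. complex_of_real (1/2) \<cdot> (X x \<oplus> visser X n (visser X n x)))"

definition in_bicommutant where
  "in_bicommutant T S \<longleftrightarrow> (\<forall>C D. adjp C D \<longrightarrow> (\<forall>x. C (T x) = T (C x)) \<longrightarrow> (\<forall>x. C (S x) = S (C x)))"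

lemma in_bicommutantD:
  "in_bicommutant T S \<Longrightarrow> adjp C D \<Longrightarrow> (\<And>x. C (T x) = T (C x)) \<Longrightarrow> C (S x) = S (C x)"
  unfolding in_bicommutant_def by blast

text \<open>Visser's iteration \<open>Y \<mapsto> (X + Y\<^sup>2) / 2\<close> converges to \<open>1 - (1 - X)\<^bsup>1/2\<^esup>\<close>; it is dominated
  by the scalar iteration \<open>visser_bound\<close> for \<open>X = 1\<close>.\<close>
theorem contraction_sqrt:
  assumes X: "sa X" and contr: "\<And>x. nm (X x) \<le> nm x"
  shows "\<exists>S. sa S \<and> (\<forall>x. S (S x) = x \<ominus> X x) \<and> (\<forall>x. nm (x \<ominus> S x) \<le> nm x) \<and> in_bicommutant X S"
proof -
  define Y where "Y = visser X"
  note y = visser_bound_nonneg visser_bound_le_1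
  have Y0 [simp]: "Y 0 x = \<zero>" and YS: "Y (Suc n) x = complex_of_real (1/2) \<cdot> (X x \<oplus> Y n (Y n x))" for n x
    by (simp_all add: Y_def)
  have sa_Y: "sa (Y n)" for n
  proof (induction n)
    case 0
    then show ?case by (simp add: adjp_def)
  next
    case (Suc n)
    show ?case
      using sa_smul[OF adjp_add[OF X adjp_comp[OF Suc Suc]], of "1/2"] by (simp add: Y_def)
  qed
  note lin = adjp_linear[OF sa_Y] adjp_linear[OF X]
  have Y_le: "nm (Y n x) \<le> visser_bound n * nm x" for n x
  proof (induction n arbitrary: x)
    case (Suc n)
    have "nm (X x \<oplus> Y n (Y n x)) \<le> nm (X x) + nm (Y n (Y n x))"
      by (rule nm_triangle)
    also have "\<dots> \<le> nm x + visser_bound n * (visser_bound n * nm x)"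
      by (intro add_mono contr order_trans[OF Suc] mult_left_mono y order_refl)
    finally show ?case
      unfolding YS by (subst nm_smul_of_real) (auto simp: power2_eq_square algebra_simps)
  qed simp
  have Y_le1: "nm (Y n x) \<le> nm x" for n x
    using Y_le[of n x] mult_right_mono[OF y(2)[of n] nm_nonneg[of x]] by simp
  have Y_step: "nm (Y (Suc n) x \<ominus> Y n x) \<le> (visser_bound (Suc n) - visser_bound n) * nm x" for n x
  proof (induction n arbitrary: x)
    case 0
    have "nm (Y (Suc 0) x \<ominus> Y 0 x) = nm (X x) / 2"
      unfolding YS by (simp add: nm_smul)
    then show ?case
      using contr[of x] by simp
  next
    case (Suc n)
    let ?y = visser_bound
    let ?d = "?y (Suc n) - ?y n"
    have d: "?d \<ge> 0"
      using monoD[OF visser_bound_mono, of n "Suc n"] by (simp del: visser_bound.simps)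
    have "Y (Suc (Suc n)) x \<ominus> Y (Suc n) x
        = complex_of_real (1/2) \<cdot> ((X x \<oplus> Y (Suc n) (Y (Suc n) x)) \<ominus> (X x \<oplus> Y n (Y n x)))"
      unfolding YS[of "Suc n"] YS[of n x] smul_diff_right ..
    \<comment> \<open>The splitting \<open>U U - V V = U (U - V) + (U - V) V\<close> needs no
      commutativity and copies the factorisation of a difference of scalar squares, so the
      increments of \<open>visser_bound\<close> come out exactly.\<close>
    also have "(X x \<oplus> Y (Suc n) (Y (Suc n) x)) \<ominus> (X x \<oplus> Y n (Y n x))
        = Y (Suc n) (Y (Suc n) x \<ominus> Y n x) \<oplus> (Y (Suc n) (Y n x) \<ominus> Y n (Y n x))"
      by (simp add: lin vec.add_diff_eq)
    finally have "nm (Y (Suc (Suc n)) x \<ominus> Y (Suc n) x)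
      = 1/2 * nm (Y (Suc n) (Y (Suc n) x \<ominus> Y n x) \<oplus> (Y (Suc n) (Y n x) \<ominus> Y n (Y n x)))"
      by (simp add: nm_smul)
    also have "\<dots> \<le> 1/2 * (?y (Suc n) * (?d * nm x) + ?d * (?y n * nm x))"
      by (intro mult_left_mono order_trans[OF nm_triangle] add_mono order_trans[OF Y_le]
          order_trans[OF Suc] Suc Y_le y d) auto
    also have "\<dots> = (?y (Suc (Suc n)) - ?y (Suc n)) * nm x"
      by (simp add: power2_eq_square) (simp add: field_simps)
    finally show ?case .
  qed
  have tele: "nm (Y m x \<ominus> Y n x) \<le> (visser_bound m - visser_bound n) * nm x" if "n \<le> m" for m n x
    using that
  proof (induction m rule: dec_induct)
    case (step k)
    have "nm (Y (Suc k) x \<ominus> Y n x) \<le> nm (Y (Suc k) x \<ominus> Y k x) + nm (Y k x \<ominus> Y n x)"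
      by (rule nm_diff_le)
    then show ?case
      using step.IH Y_step[of k x] by (simp add: algebra_simps del: visser_bound.simps)
  qed simp
  have "\<exists>L. (\<lambda>n. nm (Y n x \<ominus> L)) \<longlonglongrightarrow> 0" for x
  proof (rule complete_H)
    fix e :: real assume "e > 0"
    have pos: "nm x + 1 > 0"
      by (simp add: add_nonneg_pos)
    obtain N where N: "\<And>m n. m \<ge> N \<Longrightarrow> n \<ge> N \<Longrightarrow> \<bar>visser_bound m - visser_bound n\<bar> < e / (nm x + 1)"
      using CauchyD[OF visser_bound_Cauchy, of "e / (nm x + 1)"] pos \<open>e > 0\<close> by auto
    have "nm (Y m x \<ominus> Y n x) < e" if "m \<ge> N" "n \<ge> N" for m n
    proof -
      have "nm (Y m x \<ominus> Y n x) \<le> \<bar>visser_bound m - visser_bound n\<bar> * nm x"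
      proof (cases "n \<le> m")
        case True
        then show ?thesis
          by (intro order_trans[OF tele] mult_right_mono) auto
      next
        case False
        then show ?thesis
          unfolding nm_minus_commute[of "Y m x"]
          by (intro order_trans[OF tele] mult_right_mono) auto
      qed
      also have "\<dots> \<le> \<bar>visser_bound m - visser_bound n\<bar> * (nm x + 1)"
        by (intro mult_left_mono) auto
      also have "\<dots> < e"
        using N[OF that] pos by (simp add: field_simps)
      finally show ?thesis .
    qed
    then show "\<exists>N. \<forall>m\<ge>N. \<forall>n\<ge>N. nm (Y m x \<ominus> Y n x) < e"
      by (intro exI[of _ N]) simp
  qed
  then obtain L where L: "\<And>x. (\<lambda>n. nm (Y n x \<ominus> L x)) \<longlonglongrightarrow> 0"
    by metis
  have L_le: "nm (L x) \<le> nm x" for x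
    by (rule nm_limit_le[OF _ L]) (rule Y_le1)
  have sa_L: "sa L"
    unfolding adjp_def
  proof (intro allI)
    fix x w
    show "ip (L x) w = ip x (L w)"
    proof (rule eq_by_limit_A)
      fix n
      have "ip (L x) w \<boxminus> ip x (L w) = ip (L x \<ominus> Y n x) w \<boxplus> ip x (Y n w \<ominus> L w)"
        by (simp add: ip_simps adjpD[OF sa_Y] alg.add_diff_eq)
      also have "na \<dots> \<le> nm (Y n x \<ominus> L x) * nm w + nm x * nm (Y n w \<ominus> L w)"
        unfolding nm_minus_commute[of "Y n x"]
        by (intro order_trans[OF norm_A(4)] add_mono cauchy_schwarz)
      finally show "na (ip (L x) w \<boxminus> ip x (L w)) \<le> nm (Y n x \<ominus> L x) * nm w + nm x * nm (Y n w \<ominus> L w)" .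
    next
      show "(\<lambda>n. nm (Y n x \<ominus> L x) * nm w + nm x * nm (Y n w \<ominus> L w)) \<longlonglongrightarrow> 0"
        by (auto intro!: tendsto_eq_intros L)
    qed
  qed
  have fix_half: "L x = complex_of_real (1/2) \<cdot> (X x \<oplus> L (L x))" for x
  proof (rule eq_by_limit)
    fix n
    have "nm (L x \<ominus> complex_of_real (1/2) \<cdot> (X x \<oplus> L (L x)))
        \<le> nm (L x \<ominus> Y (Suc n) x) + nm (Y (Suc n) x \<ominus> complex_of_real (1/2) \<cdot> (X x \<oplus> L (L x)))"
      by (rule nm_diff_le)
    also have "Y (Suc n) x \<ominus> complex_of_real (1/2) \<cdot> (X x \<oplus> L (L x))
        = complex_of_real (1/2) \<cdot> (Y n (Y n x \<ominus> L x) \<oplus> (Y n (L x) \<ominus> L (L x)))"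
      unfolding YS by (simp add: lin vec.add_diff_eq flip: smul_diff_right)
    also have "nm \<dots> \<le> 1/2 * (nm (Y n x \<ominus> L x) + nm (Y n (L x) \<ominus> L (L x)))"
      by (subst nm_smul_of_real)
        (auto intro!: order_trans[OF nm_triangle] add_mono Y_le1)
    finally show "nm (L x \<ominus> complex_of_real (1/2) \<cdot> (X x \<oplus> L (L x)))
      \<le> nm (Y (Suc n) x \<ominus> L x) + 1/2 * (nm (Y n x \<ominus> L x) + nm (Y n (L x) \<ominus> L (L x)))"
      unfolding nm_minus_commute[of "L x" "Y (Suc n) x"] by simp
  next
    show "(\<lambda>n. nm (Y (Suc n) x \<ominus> L x) + 1/2 * (nm (Y n x \<ominus> L x) + nm (Y n (L x) \<ominus> L (L x))))
        \<longlonglongrightarrow> 0"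
      by (auto intro!: tendsto_eq_intros L LIMSEQ_Suc[OF L])
  qed
  \<comment> \<open>Equivalent to \<open>(1 - L)\<^sup>2 = 1 - X\<close>, which is why
    \<open>1 - L\<close> is the root sought.\<close>
  have fixpoint: "L x \<oplus> L x = X x \<oplus> L (L x)" for x
    using arg_cong[OF fix_half[of x], of "\<lambda>u. 2 \<cdot> u"] by (simp flip: smul_two)
  \<comment> \<open>Every iterate is a polynomial in \<open>X\<close> and commutes with
    \<open>C\<close>; boundedness of \<open>C\<close> carries this to the limit.\<close>
  have commute: "C (L x) = L (C x)" if C: "adjp C D" "\<And>x. C (X x) = X (C x)" for C D x
  proof -
    obtain K where K: "K > 0" "\<And>x. nm (C x) \<le> K * nm x"
      using adjp_bounded[OF C(1)] by blast
    have CY: "C (Y n x) = Y n (C x)" for n x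
      by (induction n arbitrary: x) (simp_all add: YS adjp_linear[OF C(1)] C(2))
    show ?thesis
    proof (rule eq_by_limit)
      fix n
      have "C (L x) \<ominus> L (C x) = C (L x \<ominus> Y n x) \<oplus> (Y n (C x) \<ominus> L (C x))"
        by (simp add: adjp_linear[OF C(1)] CY vec.add_diff_eq)
      also have "nm \<dots> \<le> K * nm (L x \<ominus> Y n x) + nm (Y n (C x) \<ominus> L (C x))"
        by (intro order_trans[OF nm_triangle] add_mono K order_refl)
      finally show "nm (C (L x) \<ominus> L (C x)) \<le> K * nm (Y n x \<ominus> L x) + nm (Y n (C x) \<ominus> L (C x))"
        unfolding nm_minus_commute[of "L x"] .
    next
      show "(\<lambda>n. K * nm (Y n x \<ominus> L x) + nm (Y n (C x) \<ominus> L (C x))) \<longlonglongrightarrow> 0"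
        by (auto intro!: tendsto_eq_intros L)
    qed
  qed
  show ?thesis
  proof (intro exI[of _ "\<lambda>x. x \<ominus> L x"] conjI allI)
    show "sa (\<lambda>x. x \<ominus> L x)"
      by (rule adjp_diff[OF adjp_id sa_L])
    show "(x \<ominus> L x) \<ominus> L (x \<ominus> L x) = x \<ominus> X x" for x
    proof -
      have "(x \<ominus> L x) \<ominus> L (x \<ominus> L x) = (x \<oplus> L (L x)) \<ominus> (L x \<oplus> L x)"
        by (simp add: adjp_linear[OF sa_L] vec.diff_diff_eq2 vec.diff_diff_add vec.add_diff_eq vec.diff_add_eq)
      then show ?thesis
        by (simp add: fixpoint)
    qed
    show "nm (x \<ominus> (x \<ominus> L x)) \<le> nm x" for x
      using L_le by (simp add: vec.diff_diff_eq2)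
    show "in_bicommutant X (\<lambda>x. x \<ominus> L x)"
      unfolding in_bicommutant_def using commute by (simp add: adjp_linear)
  qed
qed

end

subsection \<open>Positive operators\<close>

text \<open>Log-convexity makes the successive ratios nondecreasing. If the first ratio
  \<open>\<rho>\<close> exceeded \<open>t\<close>, then \<open>a n\<close> would be at least
  \<open>\<rho> ^ n * a 0\<close>, which outgrows \<open>t ^ n\<close> times an affine function of
  \<open>n\<close>.\<close>

lemma log_convex_growth:
  fixes a :: "nat \<Rightarrow> real"
  assumes nonneg: "\<And>n. a n \<ge> 0" and lc: "\<And>n. (a (Suc n))\<^sup>2 \<le> a n * a (Suc (Suc n))"
    and t: "t > 0" and growth: "\<And>n. a n \<le> t ^ n * (\<alpha> + \<beta> * real n)"
  shows "a 1 \<le> t * a 0"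
proof (rule ccontr)
  assume "\<not> a 1 \<le> t * a 0"
  then have less: "t * a 0 < a 1" by simp
  have a0: "a 0 > 0"
  proof (rule ccontr)
    assume "\<not> a 0 > 0"
    then have "a 0 = 0" using nonneg[of 0] by simp
    then show False using lc[of 0] less by simp
  qed
  define \<rho> where "\<rho> = a 1 / a 0"
  have \<rho>: "\<rho> > t"
    using less a0 by (simp add: \<rho>_def field_simps)
  then have "\<rho> > 0"
    using t by simp
  note \<rho> = \<rho> this
  have ratio: "a n > 0 \<and> \<rho> * a n \<le> a (Suc n)" for n
  proof (induction n)
    case 0
    then show ?case using a0 by (simp add: \<rho>_def)
  next
    case (Suc n)
    then have p: "a n > 0" "a (Suc n) > 0"
      using \<rho> by (auto intro: less_le_trans[OF mult_pos_pos])
    have "(\<rho> * a n) * a (Suc n) \<le> (a (Suc n))\<^sup>2"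
      using Suc p by (simp add: power2_eq_square)
    also have "\<dots> \<le> a n * a (Suc (Suc n))"
      by (rule lc)
    finally have "a n * (\<rho> * a (Suc n)) \<le> a n * a (Suc (Suc n))"
      by (simp add: mult_ac)
    then show ?case using p by simp
  qed
  have lower: "\<rho> ^ n * a 0 \<le> a n" for n
  proof (induction n)
    case (Suc n)
    have "\<rho> ^ Suc n * a 0 = \<rho> * (\<rho> ^ n * a 0)" by simp
    also have "\<dots> \<le> \<rho> * a n" using Suc \<rho> by (intro mult_left_mono) auto
    also have "\<dots> \<le> a (Suc n)" using ratio by blast
    finally show ?case .
  qed simp
  define q where "q = t / \<rho>"
  have q: "norm q < 1" using \<rho> t by (simp add: q_def)
  have "a 0 \<le> \<alpha> * q ^ n + \<beta> * (real n * q ^ n)" for n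
  proof -
    have "\<rho> ^ n * a 0 \<le> t ^ n * (\<alpha> + \<beta> * real n)"
      using lower growth by (rule order_trans)
    then show ?thesis
      using \<rho> by (simp add: q_def power_divide field_simps)
  qed
  moreover have "(\<lambda>n. \<alpha> * q ^ n + \<beta> * (real n * q ^ n)) \<longlonglongrightarrow> \<alpha> * 0 + \<beta> * 0"
    by (intro tendsto_intros LIMSEQ_power_zero q powser_times_n_limit_0)
  ultimately have "a 0 \<le> \<alpha> * 0 + \<beta> * 0"
    by (intro LIMSEQ_le_const) auto
  then show False using a0 by simp
qed

context hilb_module_cs
begin

text \<open>Asks for a self-adjoint root, which is stronger on its face than a factorisation
  \<open>c* c\<close>; that the latter suffices is \<open>pos_op_adjp_comp\<close>.\<close>

definition pos_op where "pos_op T \<longleftrightarrow> (\<exists>s. sa s \<and> (\<forall>x. T x = s (s x)))"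

definition is_sqrt where
  "is_sqrt T S \<longleftrightarrow> sa S \<and> pos_op S \<and> (\<forall>x. S (S x) = T x) \<and> in_bicommutant T S"

lemma is_sqrtD:
  assumes "is_sqrt T S"
  shows "sa S" "pos_op S" "S (S x) = T x"
    "adjp C D \<Longrightarrow> (\<And>x. C (T x) = T (C x)) \<Longrightarrow> C (S x) = S (C x)"
  using assms in_bicommutantD[of T S] unfolding is_sqrt_def by blast+

lemma pos_op_sa: "pos_op T \<Longrightarrow> sa T"
  unfolding pos_op_def adjp_def by metis

text \<open>The norm condition says that \<open>1 - T / r\<close> is a contraction, so its
  complement has a root, which is scaled back by \<open>sqrt r\<close>. The root satisfies the same
  condition with \<open>sqrt r\<close>, so the lemma can be applied to it once more, and that makes
  the root itself positive.\<close>

lemma scaled_sqrt: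
  assumes T: "sa T" and r: "r > 0" and le: "\<And>x. nm (of_real r \<cdot> x \<ominus> T x) \<le> r * nm x"
  shows "\<exists>S. sa S \<and> (\<forall>x. S (S x) = T x) \<and> (\<forall>x. nm (of_real (sqrt r) \<cdot> x \<ominus> S x) \<le> sqrt r * nm x) \<and>
    in_bicommutant T S"
proof -
  define X where "X = (\<lambda>x. x \<ominus> of_real (1 / r) \<cdot> T x)"
  have X_eq: "X x = of_real (1 / r) \<cdot> (of_real r \<cdot> x \<ominus> T x)" for x
    using r by (simp add: X_def smul_diff_right)
  have "sa X"
    unfolding X_def by (intro adjp_diff adjp_id sa_smul T)
  moreover have "nm (X x) \<le> nm x" for x
    using r le[of x] unfolding X_eq by (subst nm_smul_of_real) (auto simp: field_simps)
  ultimately obtain S where S: "sa S" "\<And>x. S (S x) = x \<ominus> X x" "\<And>x. nm (x \<ominus> S x) \<le> nm x"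
    "in_bicommutant X S"
    using contraction_sqrt[of X] by blast
  show ?thesis
  proof (intro exI[of _ "\<lambda>x. of_real (sqrt r) \<cdot> S x"] conjI allI)
    show "sa (\<lambda>x. of_real (sqrt r) \<cdot> S x)"
      by (rule sa_smul[OF S(1)])
    have sq: "of_real (sqrt r) * of_real (sqrt r) = complex_of_real r"
      using r by (simp flip: of_real_mult)
    have "of_real r \<cdot> (x \<ominus> X x) = T x" for x
      using r by (simp add: X_def smul_diff_right vec.diff_diff_eq2)
    then show "of_real (sqrt r) \<cdot> S (of_real (sqrt r) \<cdot> S x) = T x" for x
      by (simp add: adjp_linear[OF S(1)] S(2) sq)
    show "nm (of_real (sqrt r) \<cdot> x \<ominus> of_real (sqrt r) \<cdot> S x) \<le> sqrt r * nm x" for x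
      using S(3)[of x] r by (simp add: nm_smul flip: smul_diff_right)
    show "in_bicommutant T (\<lambda>x. of_real (sqrt r) \<cdot> S x)"
      unfolding in_bicommutant_def
    proof (intro allI impI)
      fix C D x assume C: "adjp C D" "\<forall>x. C (T x) = T (C x)"
      have "C (X x) = X (C x)" for x
        using C by (simp add: X_def adjp_linear[OF C(1)])
      then show "C (of_real (sqrt r) \<cdot> S x) = of_real (sqrt r) \<cdot> S (C x)"
        using in_bicommutantD[OF S(4) C(1)] by (simp add: adjp_linear[OF C(1)])
    qed
  qed
qed

lemma ex_is_sqrt:
  assumes T: "sa T" and r: "r > 0" and le: "\<And>x. nm (of_real r \<cdot> x \<ominus> T x) \<le> r * nm x"
  shows "\<exists>S. is_sqrt T S"
proof -
  obtain S where S: "sa S" "\<And>x. S (S x) = T x" "\<And>x. nm (of_real (sqrt r) \<cdot> x \<ominus> S x) \<le> sqrt r * nm x"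
    "in_bicommutant T S"
    using scaled_sqrt[OF assms] by blast
  have "sqrt r > 0"
    using r by simp
  obtain R where "sa R" "\<And>x. R (R x) = S x"
    using scaled_sqrt[OF S(1) \<open>sqrt r > 0\<close> S(3)] by blast
  then have "pos_op S"
    unfolding pos_op_def by metis
  then show ?thesis
    unfolding is_sqrt_def using S by blast
qed

text \<open>The operator \<open>s + i k\<close> is \<open>r\<^bsup>1/2\<^esup>\<close> times a unitary, and \<open>s\<close> is its real part.\<close>
lemma commuting_squares_bound:
  assumes s: "sa s" and k: "sa k" and comm: "\<And>x. s (k x) = k (s x)"
    and sum: "\<And>x. s (s x) \<oplus> k (k x) = of_real r \<cdot> x" and r: "r \<ge> 0"
  shows "nm (s x) \<le> sqrt r * nm x"
proof -
  define u where "u = (\<lambda>x. s x \<oplus> \<i> \<cdot> k x)"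
  define v where "v = (\<lambda>x. s x \<oplus> (-\<i>) \<cdot> k x)"
  have uv: "adjp u v"
    using adjp_add[OF s adjp_smul[OF k, of \<i>]] by (simp add: u_def v_def)
  have cancel: "\<i> \<cdot> y \<oplus> (-\<i>) \<cdot> y = \<zero>" for y
    by (simp flip: smul_add_left)
  have cancel': "a \<oplus> (\<i> \<cdot> y \<oplus> ((-\<i>) \<cdot> y \<oplus> b)) = a \<oplus> b" for a b y
    using cancel[of y] by (metis vec.add.assoc vec.add.left_neutral)
  have vu: "v (u x) = of_real r \<cdot> x" for x
    using cancel'[of "s (s x)" "s (k x)" "k (k x)"]
    by (simp add: u_def v_def adjp_linear[OF s] adjp_linear[OF k] smul_add_right comm sum vec.add.assoc)
  have uv': "u (v x) = of_real r \<cdot> x" for x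
    using cancel'[of "s (s x)" "s (k x)" "k (k x)"]
    by (simp add: u_def v_def adjp_linear[OF s] adjp_linear[OF k] smul_add_right comm sum vec.add.assoc
        vec.add.left_commute)
  have norm_eq: "nm (a x) = sqrt r * nm x" if "adjp a b" "b (a x) = of_real r \<cdot> x" for a b x
  proof -
    have "(nm (a x))\<^sup>2 = r * (nm x)\<^sup>2"
      using r by (simp add: nm_sq adjpD[OF that(1)] that(2) ip_simps norm_A)
    also have "\<dots> = (sqrt r * nm x)\<^sup>2"
      using r by (simp add: power_mult_distrib)
    finally show ?thesis
      by (rule power2_eq_imp_eq) (simp_all add: r)
  qed
  have "2 \<cdot> s x = u x \<oplus> v x"
    using cancel'[of "s x" "k x" "s x"]
    by (simp add: u_def v_def smul_two vec.add.assoc vec.add.left_commute vec.add.commute)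
  then have "2 * nm (s x) = nm (u x \<oplus> v x)"
    using nm_smul[of 2 "s x"] by simp
  also have "\<dots> \<le> sqrt r * nm x + sqrt r * nm x"
    using nm_triangle[of "u x" "v x"] norm_eq[OF uv vu, of x] norm_eq[OF adjp_sym[OF uv] uv', of x]
    by simp
  finally show ?thesis by simp
qed

text \<open>After scaling, \<open>h h\<close> is a contraction, so \<open>t - h h\<close> has a root
  \<open>k\<close>, and \<open>k\<close> commutes with \<open>h\<close> by the bicommutant property.
  As \<open>h h + k k = t\<close>, the bound for commuting squares applies to
  \<open>k\<close>.\<close>

lemma sa_square_bound:
  assumes h: "sa h" and t: "t > 0" and le: "\<And>x. nm (h (h x)) \<le> t * nm x"
  shows "nm (of_real t \<cdot> x \<ominus> h (h x)) \<le> t * nm x"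
proof -
  define X where "X = (\<lambda>x. of_real (1 / t) \<cdot> h (h x))"
  have "sa X"
    unfolding X_def by (rule sa_smul[OF adjp_comp[OF h h]])
  moreover have "nm (X x) \<le> nm x" for x
    using t le[of x] unfolding X_def by (subst nm_smul_of_real) (auto simp: field_simps)
  ultimately obtain S where S: "sa S" "\<And>x. S (S x) = x \<ominus> X x"
    "in_bicommutant X S"
    using contraction_sqrt[of X] by blast
  have hS: "h (S x) = S (h x)" for x
    by (rule in_bicommutantD[OF S(3) h]) (simp add: X_def adjp_linear[OF h])
  define k where "k = (\<lambda>x. of_real (sqrt t) \<cdot> S x)"
  have sq: "of_real (sqrt t) * of_real (sqrt t) = complex_of_real t"
    using t by (simp flip: of_real_mult)
  have kk: "k (k x) = of_real t \<cdot> x \<ominus> h (h x)" for x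
    using t by (simp add: k_def adjp_linear[OF S(1)] S(2) sq smul_diff_right X_def)
  have "sa k"
    unfolding k_def by (rule sa_smul[OF S(1)])
  then have "nm (k x) \<le> sqrt t * nm x" for x
    using t kk by (intro commuting_squares_bound[OF _ h]) (auto simp: k_def adjp_linear[OF h] hS)
  then have "nm (k (k x)) \<le> sqrt t * (sqrt t * nm x)"
    using t by (meson order_trans mult_left_mono real_sqrt_ge_zero less_imp_le)
  then show ?thesis
    using t by (simp add: kk flip: mult.assoc)
qed

lemma pos_op_bound:
  assumes "pos_op T" "t > 0" "\<And>x. nm (T x) \<le> t * nm x"
  shows "nm (of_real t \<cdot> x \<ominus> T x) \<le> t * nm x"
proof -
  obtain h where "sa h" "\<And>x. T x = h (h x)"
    using assms(1) unfolding pos_op_def by blast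
  then show ?thesis
    using sa_square_bound[of h t x] assms by simp
qed

lemma pos_op_bounded:
  assumes "pos_op T"
  shows "\<exists>t>0. (\<forall>x. nm (T x) \<le> t * nm x) \<and> (\<forall>x. nm (of_real t \<cdot> x \<ominus> T x) \<le> t * nm x)"
  using adjp_bounded[OF pos_op_sa[OF assms]] pos_op_bound[OF assms] by blast

lemma pos_opI:
  assumes "sa T" "r > 0" "\<And>x. nm (of_real r \<cdot> x \<ominus> T x) \<le> r * nm x"
  shows "pos_op T"
  using ex_is_sqrt[OF assms] is_sqrtD(1,3) unfolding pos_op_def by metis

lemma pos_op_sqrt: "pos_op T \<Longrightarrow> \<exists>S. is_sqrt T S"
  by (metis ex_is_sqrt pos_op_bounded pos_op_sa)

text \<open>A sum of two squares has no visible root. The norm conditions for \<open>S\<close> and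
  \<open>T\<close>, however, add up by the triangle inequality to the condition for
  \<open>S + T\<close> with \<open>r + t\<close>, and \<open>pos_opI\<close> returns a root.\<close>

lemma pos_op_add:
  assumes S: "pos_op S" and T: "pos_op T"
  shows "pos_op (\<lambda>x. S x \<oplus> T x)"
proof -
  obtain r where r: "r > 0" "\<And>x. nm (of_real r \<cdot> x \<ominus> S x) \<le> r * nm x"
    using pos_op_bounded[OF S] by blast
  obtain t where t: "t > 0" "\<And>x. nm (of_real t \<cdot> x \<ominus> T x) \<le> t * nm x"
    using pos_op_bounded[OF T] by blast
  show ?thesis
  proof (rule pos_opI[of _ "r + t"])
    show "sa (\<lambda>x. S x \<oplus> T x)"
      by (intro adjp_add pos_op_sa S T)
    show "nm (of_real (r + t) \<cdot> x \<ominus> (S x \<oplus> T x)) \<le> (r + t) * nm x" for x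
    proof -
      have "of_real (r + t) \<cdot> x \<ominus> (S x \<oplus> T x) = (of_real r \<cdot> x \<ominus> S x) \<oplus> (of_real t \<cdot> x \<ominus> T x)"
        by (simp add: smul_add_left vec.add_diff_eq vec.diff_add_eq vec.diff_diff_add vec.add_ac)
      then show ?thesis
        using nm_triangle[of "of_real r \<cdot> x \<ominus> S x" "of_real t \<cdot> x \<ominus> T x"] r(2)[of x] t(2)[of x]
        by (simp add: distrib_right)
    qed
  qed (use r t in simp)
qed

lemma pos_op_smul:
  assumes "pos_op T" "c \<ge> 0"
  shows "pos_op (\<lambda>x. of_real c \<cdot> T x)"
proof -
  obtain h where h: "sa h" "\<And>x. T x = h (h x)"
    using assms(1) unfolding pos_op_def by blast
  have "of_real (sqrt c) * of_real (sqrt c) = complex_of_real c"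
    using assms(2) by (simp flip: of_real_mult)
  then show ?thesis
    unfolding pos_op_def
    by (intro exI[of _ "\<lambda>x. of_real (sqrt c) \<cdot> h x"]) (simp add: sa_smul h adjp_linear[OF h(1)])
qed

text \<open>The norm bound makes \<open>r - (X + Y)\<close> positive, and adding \<open>Y\<close>
  makes \<open>r - X\<close> positive. Its root commutes with a root \<open>s\<close> of
  \<open>X\<close>, and the two squares sum to \<open>r\<close>, so \<open>s\<close> is bounded by
  \<open>sqrt r\<close>.\<close>

lemma pos_op_mono:
  assumes X: "pos_op X" and Y: "pos_op Y" and r: "r > 0" and le: "\<And>x. nm (X x \<oplus> Y x) \<le> r * nm x"
  shows "nm (X x) \<le> r * nm x"
proof -
  obtain s where s: "sa s" "\<And>x. X x = s (s x)"
    using X unfolding pos_op_def by blast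
  have "pos_op (\<lambda>x. of_real r \<cdot> x \<ominus> (X x \<oplus> Y x))"
  proof (rule pos_opI[OF _ r])
    show "sa (\<lambda>x. of_real r \<cdot> x \<ominus> (X x \<oplus> Y x))"
      by (intro adjp_diff adjp_add sa_smul_id pos_op_sa X Y)
    show "nm (of_real r \<cdot> x \<ominus> (of_real r \<cdot> x \<ominus> (X x \<oplus> Y x))) \<le> r * nm x" for x
      using le by (simp add: vec.diff_diff_eq2)
  qed
  from pos_op_add[OF this Y] have "pos_op (\<lambda>x. of_real r \<cdot> x \<ominus> X x)"
    by (simp add: vec.diff_add_eq vec.diff_diff_add vec.add_ac flip: vec.diff_diff_add)
  then obtain k where k: "is_sqrt (\<lambda>x. of_real r \<cdot> x \<ominus> X x) k"
    using pos_op_sqrt by blast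
  have sk: "s (k x) = k (s x)" for x
    by (rule is_sqrtD(4)[OF k s(1)]) (simp add: adjp_linear[OF s(1)] s(2))
  have "nm (s x) \<le> sqrt r * nm x" for x
    using r by (intro commuting_squares_bound[OF s(1) is_sqrtD(1)[OF k] sk])
      (auto simp: is_sqrtD(3)[OF k] s(2))
  then have "nm (s (s x)) \<le> sqrt r * (sqrt r * nm x)"
    using r by (meson order_trans mult_left_mono real_sqrt_ge_zero less_imp_le)
  then show ?thesis
    using r by (simp add: s(2) flip: mult.assoc)
qed

section \<open>Positivity of \<open>c* c\<close>\<close>

lemma adjp_zero_of_comp:
  assumes "adjp e f" "\<And>x. e (f x) = \<zero>" shows "f x = \<zero>" "e x = \<zero>"
proof -
  have f: "f x = \<zero>" for x
    using adjpD[OF adjp_sym[OF assms(1)], of x "f x"] assms(2) by (auto intro: ip_self_zero)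
  then show "f x = \<zero>" .
  show "e x = \<zero>"
    using adjpD[OF assms(1), of x "e x"] f by (auto intro: ip_self_zero)
qed

text \<open>With \<open>M = t + q\<close> and \<open>N = t - p\<close> one has \<open>M e = e N\<close>, so \<open>M\<^sup>n q = e N\<^sup>n f\<close> grows at most
  like \<open>t\<^sup>n\<close> and \<open>M\<^sup>n\<close> at most like \<open>n t\<^sup>n\<close>. By log-convexity \<open>M\<close> is bounded by \<open>t\<close>, so \<open>-q\<close> is
  positive as well.\<close>
lemma adjp_zero_of_negative:
  assumes ef: "adjp e f" and p: "pos_op p" and q: "pos_op q"
    and fe: "\<And>x. f (e x) = (-1) \<cdot> p x" and q_eq: "\<And>x. e (f x) = q x"
  shows "e x = \<zero>"
proof -
  obtain t where t: "t > 0" "\<And>x. nm (of_real t \<cdot> x \<ominus> p x) \<le> t * nm x"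
    using pos_op_bounded[OF p] by blast
  obtain K where K: "K > 0" "\<And>x. nm (e x) \<le> K * nm x"
    using adjp_bounded[OF ef] by blast
  obtain L where L: "L > 0" "\<And>x. nm (f x) \<le> L * nm x"
    using adjp_bounded[OF adjp_sym[OF ef]] by blast
  define M where "M = (\<lambda>x. of_real t \<cdot> x \<oplus> q x)"
  define N where "N = (\<lambda>x. of_real t \<cdot> x \<ominus> p x)"
  have M_app: "M x = of_real t \<cdot> x \<oplus> q x" for x
    by (simp add: M_def)
  have sa_M: "sa M"
    unfolding M_def by (intro adjp_add sa_smul_id pos_op_sa q)
  have sa_Mn: "sa (M ^^ n)" for n
  proof (induction n)
    case 0
    then show ?case by (simp add: adjp_def)
  next
    case (Suc n)
    have "sa (\<lambda>x. M ((M ^^ n) x))"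
      by (rule sa_comp[OF sa_M Suc]) (simp add: funpow_swap1)
    then show ?case by (simp add: comp_def)
  qed
  have M_e: "M (e x) = e (N x)" for x
  proof -
    have "q (e x) = (-1) \<cdot> e (p x)"
      by (metis q_eq fe adjp_linear(3)[OF ef])
    then show ?thesis
      by (simp add: M_def N_def adjp_linear[OF ef])
  qed
  have Mn_e: "(M ^^ n) (e x) = e ((N ^^ n) x)" for n x
    by (induction n) (simp_all add: M_e)
  have Nn: "nm ((N ^^ n) x) \<le> t ^ n * nm x" for n x
  proof (induction n)
    case (Suc n)
    have "nm ((N ^^ Suc n) x) \<le> t * nm ((N ^^ n) x)"
      using t(2) by (simp add: N_def)
    also have "\<dots> \<le> t * (t ^ n * nm x)"
      using Suc t by (intro mult_left_mono) auto
    finally show ?case by simp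
  qed simp
  have Mn_q: "nm ((M ^^ n) (q x)) \<le> t ^ n * (K * L * nm x)" for n x
  proof -
    have "nm ((M ^^ n) (q x)) = nm (e ((N ^^ n) (f x)))"
      by (simp add: Mn_e flip: q_eq)
    also have "\<dots> \<le> K * (t ^ n * (L * nm x))"
      using K(1) t(1) by (intro order_trans[OF K(2)] mult_left_mono order_trans[OF Nn] L) auto
    finally show ?thesis by (simp add: mult_ac)
  qed
  \<comment> \<open>In \<open>M ^^ Suc n = t (M ^^ n) + (M ^^ n) q\<close> the last term is only of
    order \<open>t ^ n\<close>, so each step adds a constant multiple of \<open>t ^ n\<close> and
    the factor grows linearly.\<close>
  have Mn: "nm ((M ^^ n) x) \<le> t ^ n * (nm x + K * L * nm x / t * real n)" for n x
  proof (induction n)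
    case (Suc n)
    have "(M ^^ Suc n) x = of_real t \<cdot> (M ^^ n) x \<oplus> (M ^^ n) (q x)"
      using M_app[of x] by (simp add: funpow_swap1 adjp_linear[OF sa_Mn])
    then have "nm ((M ^^ Suc n) x) \<le> t * nm ((M ^^ n) x) + nm ((M ^^ n) (q x))"
      using nm_triangle[of "of_real t \<cdot> (M ^^ n) x" "(M ^^ n) (q x)"] t(1) by (simp add: nm_smul)
    also have "\<dots> \<le> t * (t ^ n * (nm x + K * L * nm x / t * real n)) + t ^ n * (K * L * nm x)"
      using t(1) by (intro add_mono mult_left_mono Suc Mn_q) auto
    also have "\<dots> = t ^ Suc n * (nm x + K * L * nm x / t * real (Suc n))"
      using t(1) by (simp add: field_simps)
    finally show ?case .
  qed simp
  have M_le: "nm (M x) \<le> t * nm x" for x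
  proof -
    have "nm ((M ^^ 1) x) \<le> t * nm ((M ^^ 0) x)"
    proof (rule log_convex_growth[where a = "\<lambda>n. nm ((M ^^ n) x)", OF _ _ t(1) Mn])
      fix n
      have "(nm (M ((M ^^ n) x)))\<^sup>2 = na (ip ((M ^^ n) x) (M (M ((M ^^ n) x))))"
        by (simp add: nm_sq adjpD[OF sa_M])
      also have "\<dots> \<le> nm ((M ^^ n) x) * nm (M (M ((M ^^ n) x)))"
        by (rule cauchy_schwarz)
      finally show "(nm ((M ^^ Suc n) x))\<^sup>2 \<le> nm ((M ^^ n) x) * nm ((M ^^ Suc (Suc n)) x)"
        by simp
    qed simp
    then show ?thesis by simp
  qed
  have sa_nq: "sa (\<lambda>x. (-1) \<cdot> q x)"
    using sa_smul[OF pos_op_sa[OF q], of "-1"] by simp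
  \<comment> \<open>The bound on \<open>M\<close>, read as a bound on \<open>t - (-q)\<close>, is
    the norm criterion for \<open>-q\<close>.\<close>
  have "nm (of_real t \<cdot> x \<ominus> (-1) \<cdot> q x) \<le> t * nm x" for x
    using M_le[of x] by (simp add: M_def)
  then obtain k where k: "is_sqrt (\<lambda>x. (-1) \<cdot> q x) k"
    using ex_is_sqrt[OF sa_nq t(1)] by blast
  obtain s where s: "sa s" "\<And>x. q x = s (s x)"
    using q unfolding pos_op_def by blast
  have sk: "s (k x) = k (s x)" for x
    by (rule is_sqrtD(4)[OF k s(1)]) (simp add: adjp_linear[OF s(1)] s(2))
  \<comment> \<open>\<open>s\<close> and \<open>k\<close> are commuting roots of \<open>q\<close>
    and \<open>-q\<close>, so their squares sum to zero and the bound holds with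
    \<open>r = 0\<close>.\<close>
  have "nm (s x) \<le> sqrt 0 * nm x" for x
    by (rule commuting_squares_bound[OF s(1) is_sqrtD(1)[OF k] sk]) (simp_all add: is_sqrtD(3)[OF k] s(2))
  then have "s x = \<zero>" for x
    using nm_nonneg[of "s x"] by (metis mult_zero_left nm_eq_0 order_antisym real_sqrt_zero)
  then have "e (f x) = \<zero>" for x
    by (simp add: q_eq s(2))
  then show ?thesis
    using adjp_zero_of_comp[OF ef] by blast
qed

text \<open>Kaplansky's argument: with \<open>h = d c\<close>, \<open>m = (h\<^sup>2)\<^bsup>1/2\<^esup>\<close> and \<open>g = m - h\<close>, the operator
  \<open>e = c g\<close> satisfies \<open>e* e = - g\<^sup>2 m\<close>.\<close>
theorem pos_op_adjp_comp:
  assumes cd: "adjp c d"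
  shows "pos_op (\<lambda>x. d (c x))"
proof -
  define h where "h = (\<lambda>x. d (c x))"
  have sa_h: "sa h"
    unfolding h_def by (rule adjp_comp[OF adjp_sym[OF cd] cd])
  have "pos_op (\<lambda>x. h (h x))"
    unfolding pos_op_def using sa_h by blast
  then obtain m where m: "is_sqrt (\<lambda>x. h (h x)) m"
    using pos_op_sqrt by blast
  note sa_m = is_sqrtD(1)[OF m] and mm = is_sqrtD(3)[OF m]
  obtain r where r: "is_sqrt m r"
    using pos_op_sqrt[OF is_sqrtD(2)[OF m]] by blast
  note sa_r = is_sqrtD(1)[OF r] and rr = is_sqrtD(3)[OF r]
  have hm: "h (m x) = m (h x)" for x
    by (rule is_sqrtD(4)[OF m sa_h]) simp
  \<comment> \<open>With \<open>m\<close> the modulus of \<open>h\<close>, this is twice the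
    negative part of \<open>h\<close>; the aim is to show that it vanishes.\<close>
  define g where "g = (\<lambda>x. m x \<ominus> h x)"
  have sa_g: "sa g"
    unfolding g_def by (rule adjp_diff[OF sa_m sa_h])
  have gm: "g (m x) = m (g x)" for x
    by (simp add: g_def adjp_linear[OF sa_m] hm)
  have gr: "g (r x) = r (g x)" for x
    by (rule is_sqrtD(4)[OF r sa_g gm])
  have hg: "h (g x) = (-1) \<cdot> g (m x)" for x
    by (simp add: g_def adjp_linear[OF sa_h] smul_diff_right hm mm)
  have gh: "g (h x) = h (g x)" for x
    by (simp add: g_def adjp_linear[OF sa_h] hm)
  \<comment> \<open>An explicit self-adjoint root of \<open>g g m\<close>: the root \<open>r\<close>
    of \<open>m\<close> commutes with \<open>g\<close>.\<close>
  define w where "w = (\<lambda>x. g (r x))"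
  have sa_w: "sa w"
    unfolding w_def by (rule sa_comp[of g r, OF sa_g sa_r gr])
  have ww: "w (w x) = g (g (m x))" for x
    by (simp add: w_def rr flip: gr)
  have p: "pos_op (\<lambda>x. g (g (m x)))"
    unfolding pos_op_def by (intro exI[of _ w]) (simp add: sa_w ww)
  define e where "e = (\<lambda>x. c (g x))"
  define f where "f = (\<lambda>x. g (d x))"
  have ef: "adjp e f"
    unfolding e_def f_def by (rule adjp_comp[OF cd sa_g])
  note lin = adjp_linear[OF ef] adjp_linear[OF adjp_sym[OF ef]]
  have fe: "f (e x) = (-1) \<cdot> g (g (m x))" for x
    using hg[of x] by (simp add: e_def f_def h_def adjp_linear[OF sa_g])
  \<comment> \<open>Up to normalisation, \<open>u\<close> and \<open>v\<close> are the real and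
    imaginary parts of \<open>e\<close>. From \<open>u u + v v = 2 (e f + f e)\<close> and
    \<open>f e = - g g m\<close>, the product \<open>e f\<close> becomes a sum of positive
    operators.\<close>
  define u where "u = (\<lambda>x. e x \<oplus> f x)"
  define v where "v = (\<lambda>x. \<i> \<cdot> (e x \<ominus> f x))"
  have sa_u: "sa u"
    unfolding u_def using adjp_add[OF ef adjp_sym[OF ef]] by (simp add: vec.add.commute)
  have sa_v: "sa v"
  proof -
    have "(- \<i>) \<cdot> (f x \<ominus> e x) = \<i> \<cdot> (e x \<ominus> f x)" for x
      using smul_smul[of \<i> "-1" "f x \<ominus> e x"] by (simp del: smul_smul)
    then show ?thesis
      using adjp_smul[OF adjp_diff[OF ef adjp_sym[OF ef]], of \<i>] by (simp add: v_def)
  qed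
  have uv: "u (u x) \<oplus> v (v x) = 2 \<cdot> (e (f x) \<oplus> f (e x))" for x
  proof -
    have "v (v x) = (-1) \<cdot> (e (e x) \<ominus> e (f x) \<ominus> (f (e x) \<ominus> f (f x)))"
      by (simp add: v_def lin smul_diff_right)
    also have "\<dots> = (e (f x) \<oplus> f (e x)) \<ominus> (e (e x) \<oplus> f (f x))"
      by (simp add: vec.diff_diff_eq2 vec.diff_diff_add vec.add_diff_eq vec.diff_add_eq vec.add_ac)
    finally have vv: "v (v x) = (e (f x) \<oplus> f (e x)) \<ominus> (e (e x) \<oplus> f (f x))" .
    have uu: "u (u x) = (e (f x) \<oplus> f (e x)) \<oplus> (e (e x) \<oplus> f (f x))"
      by (simp add: u_def lin vec.add_ac)
    show ?thesis
      unfolding uu vv smul_two vec.add.assoc[of "e (f x) \<oplus> f (e x)"] vec_add_diff ..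
  qed
  have "pos_op (\<lambda>x. of_real (1/2) \<cdot> (u (u x) \<oplus> v (v x)) \<oplus> g (g (m x)))"
    by (intro pos_op_add pos_op_smul p) (use sa_u sa_v in \<open>auto simp: pos_op_def\<close>)
  then have q: "pos_op (\<lambda>x. e (f x))"
    by (simp add: uv fe vec.diff_add_cancel)
  have e0: "e x = \<zero>" for x
    by (rule adjp_zero_of_negative[OF ef p q fe]) simp
  then have "g (g (m x)) = \<zero>" for x
    using fe[of x] by (simp add: lin)
  then have "w x = \<zero>" for x
    using sa_square_eq_0[OF sa_w] ww by simp
  then have gm0: "g (m x) = \<zero>" for x
    by (metis rr w_def)
  \<comment> \<open>Both terms vanish, since \<open>g h = h g = - g m\<close> and
    \<open>g m = 0\<close>.\<close>
  have "g (g x) = g (m x) \<ominus> g (h x)" for x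
    using adjp_linear(2)[OF sa_g, of "m x" "h x"] by (simp add: g_def)
  then have "g (g x) = \<zero>" for x
    using gm0 gh hg by simp
  then have "g x = \<zero>" for x
    using sa_square_eq_0[OF sa_g] by blast
  then have "m = h"
    by (auto simp: g_def)
  then show ?thesis
    using is_sqrtD(2)[OF m] by (simp add: h_def)
qed

text \<open>Approximate solutions \<open>v\<close> of \<open>\<epsilon> v + b* b v = z\<close> make \<open>b z - b b* b v\<close> small.\<close>
lemma adjp_comp_dense:
  assumes adj: "adjp b c" and "\<delta> > 0"
  shows "\<exists>v. nm (b z \<ominus> b (c (b v))) < \<delta>"
proof -
  define R where "R = (\<lambda>x. c (b x))"
  have R: "pos_op R"
    unfolding R_def by (rule pos_op_adjp_comp[OF adj])
  note linR = adjp_linear[OF pos_op_sa[OF R]]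
  obtain t where t: "t > 0" "\<And>x. nm (R x) \<le> t * nm x" "\<And>x. nm (of_real t \<cdot> x \<ominus> R x) \<le> t * nm x"
    using pos_op_bounded[OF R] by blast
  obtain K where K: "K > 0" "\<And>x. nm (b x) \<le> K * nm x"
    using adjp_bounded[OF adj] by blast
  \<comment> \<open>A Richardson iteration: correcting \<open>v\<close> by
    \<open>1 / (t + \<epsilon>)\<close> times the residual multiplies the residual by
    \<open>(t - R) / (t + \<epsilon>)\<close>. Positivity of \<open>R\<close> bounds the numerator
    by \<open>t\<close>, so the factor is below 1.\<close>
  have approx: "\<exists>v. nm (z \<ominus> (of_real \<epsilon> \<cdot> v \<oplus> R v)) \<le> (t / (t + \<epsilon>)) ^ n * nm z" if "\<epsilon> > 0" for \<epsilon> n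
  proof (induction n)
    case 0
    show ?case by (rule exI[of _ \<zero>]) (simp add: linR)
  next
    case (Suc n)
    then obtain v where v: "nm (z \<ominus> (of_real \<epsilon> \<cdot> v \<oplus> R v)) \<le> (t / (t + \<epsilon>)) ^ n * nm z"
      by blast
    define \<rho> where "\<rho> = z \<ominus> (of_real \<epsilon> \<cdot> v \<oplus> R v)"
    define a where "a = 1 / (t + \<epsilon>)"
    have a: "a > 0" "a * (t + \<epsilon>) = 1"
      using t(1) that by (simp_all add: a_def)
    from a(2) have a': "complex_of_real a * of_real (t + \<epsilon>) = 1"
      by (metis of_real_1 of_real_mult)
    define v' where "v' = v \<oplus> of_real a \<cdot> \<rho>"
    have "z \<ominus> (of_real \<epsilon> \<cdot> v' \<oplus> R v') = \<rho> \<ominus> of_real a \<cdot> (of_real \<epsilon> \<cdot> \<rho> \<oplus> R \<rho>)"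
      by (simp add: v'_def \<rho>_def linR smul_add_right vec.diff_diff_add vec.add_ac mult.commute)
    also have "\<dots> = of_real a \<cdot> (of_real t \<cdot> \<rho> \<ominus> R \<rho>)"
    proof -
      have "of_real a \<cdot> (of_real t \<cdot> \<rho> \<oplus> of_real \<epsilon> \<cdot> \<rho>) = \<rho>"
        using a' by (simp flip: smul_add_left)
      moreover have "of_real a \<cdot> (of_real t \<cdot> \<rho> \<oplus> of_real \<epsilon> \<cdot> \<rho>) \<ominus> of_real a \<cdot> (of_real \<epsilon> \<cdot> \<rho> \<oplus> R \<rho>)
          = of_real a \<cdot> (of_real t \<cdot> \<rho> \<ominus> R \<rho>)"
        by (simp add: vec.add.commute[of "of_real t \<cdot> \<rho>"] flip: smul_diff_right)
      ultimately show ?thesis by simp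
    qed
    finally have "nm (z \<ominus> (of_real \<epsilon> \<cdot> v' \<oplus> R v')) = a * nm (of_real t \<cdot> \<rho> \<ominus> R \<rho>)"
      using a(1) by (simp add: nm_smul)
    also have "\<dots> \<le> a * (t * ((t / (t + \<epsilon>)) ^ n * nm z))"
      using a(1) t v unfolding \<rho>_def[symmetric]
      by (intro mult_left_mono order_trans[OF t(3)]) auto
    also have "\<dots> = (t / (t + \<epsilon>)) ^ Suc n * nm z"
      by (simp add: a_def)
    finally show ?case by blast
  qed
  \<comment> \<open>The final error is at most \<open>\<eta> * (K + 3) * nm z\<close>; the added 1
    makes the estimate strict. The term \<open>\<epsilon> b v\<close> is only of order
    \<open>sqrt \<epsilon>\<close>, hence \<open>\<epsilon>\<close> is taken as the square of
    \<open>\<eta>\<close>.\<close>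
  define \<eta> where "\<eta> = min 1 (\<delta> / ((K + 3) * nm z + 1))"
  have pos: "(K + 3) * nm z + 1 > 0"
    using K(1) by (intro add_nonneg_pos mult_nonneg_nonneg) auto
  have \<eta>: "0 < \<eta>" "\<eta> \<le> 1" "\<eta> * ((K + 3) * nm z + 1) \<le> \<delta>"
    using pos \<open>\<delta> > 0\<close> by (auto simp: \<eta>_def pos_le_divide_eq[symmetric])
  define \<epsilon> where "\<epsilon> = \<eta>\<^sup>2"
  have \<epsilon>: "0 < \<epsilon>" "\<epsilon> \<le> 1" "\<epsilon> \<le> \<eta>"
    using \<eta> by (auto simp: \<epsilon>_def power2_eq_square mult_left_le mult_le_one)
  have "t / (t + \<epsilon>) < 1"
    using t \<epsilon> by simp
  then obtain n where n: "(t / (t + \<epsilon>)) ^ n < \<epsilon>"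
    using real_arch_pow_inv[OF \<epsilon>(1), of "t / (t + \<epsilon>)"] by auto
  obtain v where v: "nm (z \<ominus> (of_real \<epsilon> \<cdot> v \<oplus> R v)) \<le> (t / (t + \<epsilon>)) ^ n * nm z"
    using approx[OF \<epsilon>(1)] by blast
  define \<rho> where "\<rho> = z \<ominus> (of_real \<epsilon> \<cdot> v \<oplus> R v)"
  have \<rho>: "nm \<rho> \<le> \<epsilon> * nm z"
    using v mult_right_mono[OF less_imp_le[OF n] nm_nonneg[of z]] by (simp add: \<rho>_def)
  have \<rho>': "nm \<rho> \<le> nm z"
    using \<rho> mult_right_mono[OF \<epsilon>(2) nm_nonneg[of z]] by simp
  have sum_le: "nm (of_real \<epsilon> \<cdot> v \<oplus> R v) \<le> 2 * nm z"
    using nm_triangle_diff[of z \<rho>] \<rho>' by (simp add: \<rho>_def vec.diff_diff_eq2)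
  \<comment> \<open>Splitting \<open>(t + \<epsilon>) v\<close> into
    \<open>\<epsilon> v + R v\<close> and \<open>t v - R v\<close> costs \<open>t * nm v\<close> for
    the second part, which cancels and leaves a bound on \<open>\<epsilon> * nm v\<close>.\<close>
  have v_le: "\<epsilon> * nm v \<le> 2 * nm z"
  proof -
    have "of_real (t + \<epsilon>) \<cdot> v = (of_real \<epsilon> \<cdot> v \<oplus> R v) \<oplus> (of_real t \<cdot> v \<ominus> R v)"
      by (simp add: smul_add_left vec.add_diff_eq vec.add.assoc vec.add.left_commute vec.add.commute)
    then have "(t + \<epsilon>) * nm v \<le> nm (of_real \<epsilon> \<cdot> v \<oplus> R v) + nm (of_real t \<cdot> v \<ominus> R v)"
      using nm_triangle[of "of_real \<epsilon> \<cdot> v \<oplus> R v" "of_real t \<cdot> v \<ominus> R v"]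
        nm_smul_of_real[of "t + \<epsilon>" v] t(1) \<epsilon>(1) by simp
    then show ?thesis
      using sum_le t(3)[of v] by (simp add: distrib_right)
  qed
  have R_le: "nm (R v) \<le> 4 * nm z"
    using nm_triangle_diff[of "of_real \<epsilon> \<cdot> v \<oplus> R v" "of_real \<epsilon> \<cdot> v"] sum_le v_le \<epsilon>(1)
    by (simp add: nm_smul)
  have b_le: "nm (of_real \<epsilon> \<cdot> b v) \<le> 3 * \<eta> * nm z"
  proof (rule power2_le_imp_le)
    have "(nm (of_real \<epsilon> \<cdot> b v))\<^sup>2 = \<epsilon>\<^sup>2 * na (ip v (R v))"
      using \<epsilon>(1) by (simp add: nm_smul power_mult_distrib nm_sq adjpD[OF adj] R_def)
    also have "\<dots> \<le> \<epsilon>\<^sup>2 * (nm v * nm (R v))"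
      by (intro mult_left_mono cauchy_schwarz) simp
    also have "\<dots> = \<epsilon> * ((\<epsilon> * nm v) * nm (R v))"
      by (simp add: power2_eq_square)
    also have "\<dots> \<le> \<epsilon> * ((2 * nm z) * (4 * nm z))"
      using \<epsilon>(1) by (intro mult_left_mono mult_mono v_le R_le) auto
    also have "\<dots> \<le> (3 * \<eta> * nm z)\<^sup>2"
      using \<eta>(1) by (simp add: \<epsilon>_def power2_eq_square less_imp_le)
    finally show "(nm (of_real \<epsilon> \<cdot> b v))\<^sup>2 \<le> (3 * \<eta> * nm z)\<^sup>2" .
  qed (use \<eta> in simp)
  have "b z \<ominus> b (c (b v)) = b \<rho> \<oplus> of_real \<epsilon> \<cdot> b v"
    by (simp add: \<rho>_def adjp_linear[OF adj] R_def vec.diff_diff_add vec.diff_add_eq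
        vec.add.commute[of "b z"])
  then have "nm (b z \<ominus> b (c (b v))) \<le> K * nm \<rho> + 3 * \<eta> * nm z"
    using nm_triangle[of "b \<rho>" "of_real \<epsilon> \<cdot> b v"] K(2)[of \<rho>] b_le by simp
  also have "\<dots> \<le> K * (\<eta> * nm z) + 3 * \<eta> * nm z"
    using K(1) \<eta>(1) \<rho> mult_right_mono[OF \<epsilon>(3) nm_nonneg[of z]]
    by (intro add_mono mult_left_mono) auto
  also have "\<dots> < \<eta> * ((K + 3) * nm z + 1)"
    using \<eta>(1) by (simp add: algebra_simps)
  also note \<eta>(3)
  finally show ?thesis by blast
qed

end

subsection \<open>The Cauchy--Schwarz inequality\<close>

definition self_module :: "'a cstar_alg \<Rightarrow> ('a, 'a) hilb_mod" where
  "self_module A = \<lparr>hm_add = ca_add A, hm_zero = ca_zero A, hm_smul = ca_smul A, hm_act = ca_mult A,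
     hm_inner = (\<lambda>x y. ca_mult A (ca_star A x) y)\<rparr>"

context hilb_module
begin

lemma self_module_norm: "hm_norm A (self_module A) a = na a"
  by (simp add: hm_norm_def self_module_def norm_A)

lemma self_module_simps:
  "hm_add (self_module A) = ca_add A" "hm_zero (self_module A) = ca_zero A"
  "hm_smul (self_module A) = ca_smul A" "hm_act (self_module A) = ca_mult A"
  "hm_inner (self_module A) a b = star a \<boxtimes> b"
  "hm_minus (self_module A) = vminus (ca_add A) (ca_smul A)"
  by (simp_all add: self_module_def hm_minus_def fun_eq_iff)

text \<open>By the \<open>C*\<close>-identity the module norm is the norm of the algebra, so
  completeness is inherited, and Cauchy--Schwarz is submultiplicativity together with the isometric
  star.\<close>

lemma self_module_cs: "hilb_module_cs A (self_module A)"
proof -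
  have zero: "a = ca_zero A" if "star a \<boxtimes> a = ca_zero A" for a
    by (metis that star_A(5) norm_A(2) zero_eq_power2)
  have complete: "\<forall>X::nat \<Rightarrow> 'a. (\<forall>e>0. \<exists>N. \<forall>m\<ge>N. \<forall>n\<ge>N. na (X m \<boxminus> X n) < e)
        \<longrightarrow> (\<exists>L. (\<lambda>n. na (X n \<boxminus> L)) \<longlonglongrightarrow> 0)"
    using banach_A unfolding complex_banach_def by (elim conjE)
  have "hilbert_module A (self_module A)"
    unfolding hilbert_module_def self_module_simps self_module_norm
  proof (intro conjI allI impI)
    show "cstar_algebra A" by (rule cstar)
    show "complex_vs (ca_add A) (ca_zero A) (ca_smul A)" by (rule vs_A)
  next
    fix X :: "nat \<Rightarrow> 'a" assume "\<forall>e>0. \<exists>N. \<forall>m\<ge>N. \<forall>n\<ge>N. na (X m \<boxminus> X n) < e"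
    then show "\<exists>L. (\<lambda>n. na (X n \<boxminus> L)) \<longlonglongrightarrow> 0"
      by (rule complete[THEN spec, THEN mp])
  next
    fix x assume "star x \<boxtimes> x = ca_zero A"
    then show "x = ca_zero A" by (rule zero)
  next
    fix x show "ca_pos A (star x \<boxtimes> x)"
      unfolding ca_pos_def by blast
  qed (simp_all add: mult_A)
  then show ?thesis
    unfolding hilb_module_cs_def hilb_module_def hilb_module_cs_axioms_def
    using mult_A(6)[of "star x" y for x y] by (simp add: self_module_simps self_module_norm)
qed

lemmas self_module_hilb_module = hilb_module_cs.axioms(1)[OF self_module_cs]

lemma self_module_adjp: "hilb_module.adjp (self_module A) (ca_mult A a) (ca_mult A (star a))"
  by (simp add: hilb_module.adjp_def[OF self_module_hilb_module] self_module_simps mult_A)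

abbreviation self_pos where "self_pos \<equiv> hilb_module_cs.pos_op (self_module A)"

abbreviation self_sa where "self_sa T \<equiv> hilb_module.adjp (self_module A) T T"

text \<open>Left multiplications by the three squares are positive operators, so
  \<open>pos_op_mono\<close> bounds the first by the sum. As the algebra may have no unit, the bound
  is evaluated at \<open>a = b* b\<close> itself, where the \<open>C*\<close>-identity turns the
  left side into \<open>(na a)\<^sup>2\<close>. The \<open>\<epsilon>\<close> keeps \<open>r\<close>
  positive when the sum is zero.\<close>

lemma norm_le_norm_sum_squares:
  "na (star b \<boxtimes> b) \<le> na (star b \<boxtimes> b \<boxplus> (star c \<boxtimes> c \<boxplus> star d \<boxtimes> d))"
proof (rule field_le_epsilon)
  fix \<epsilon> :: real assume "\<epsilon> > 0"
  define a where "a = star b \<boxtimes> b"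
  define s where "s = star b \<boxtimes> b \<boxplus> (star c \<boxtimes> c \<boxplus> star d \<boxtimes> d)"
  define r where "r = na s + \<epsilon>"
  have "r > 0"
    using \<open>\<epsilon> > 0\<close> norm_A(1)[of s] by (simp add: r_def)
  have pos: "self_pos (\<lambda>z. star x \<boxtimes> (x \<boxtimes> z))" for x
    by (rule hilb_module_cs.pos_op_adjp_comp[OF self_module_cs self_module_adjp])
  have "self_pos (\<lambda>z. star c \<boxtimes> (c \<boxtimes> z) \<boxplus> star d \<boxtimes> (d \<boxtimes> z))"
    using hilb_module_cs.pos_op_add[OF self_module_cs pos[of c] pos[of d]] by (simp add: self_module_simps)
  moreover have "na (star b \<boxtimes> (b \<boxtimes> z) \<boxplus> (star c \<boxtimes> (c \<boxtimes> z) \<boxplus> star d \<boxtimes> (d \<boxtimes> z))) \<le> r * na z" for z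
  proof -
    have "star b \<boxtimes> (b \<boxtimes> z) \<boxplus> (star c \<boxtimes> (c \<boxtimes> z) \<boxplus> star d \<boxtimes> (d \<boxtimes> z)) = s \<boxtimes> z"
      by (simp add: s_def mult_A)
    then show ?thesis
      using mult_A(6)[of s z] \<open>\<epsilon> > 0\<close> norm_A(1)[of z]
      by (simp add: r_def distrib_right) (meson add_increasing2 less_imp_le mult_nonneg_nonneg)
  qed
  ultimately have "na (star b \<boxtimes> (b \<boxtimes> a)) \<le> r * na a"
    using hilb_module_cs.pos_op_mono[OF self_module_cs pos[of b] _ \<open>r > 0\<close>, of _ a]
    by (simp add: self_module_simps self_module_norm)
  moreover have "star b \<boxtimes> (b \<boxtimes> a) = star a \<boxtimes> a"
    by (simp add: a_def mult_A)
  ultimately have "(na a)\<^sup>2 \<le> r * na a"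
    by simp
  then have "na a \<le> r"
    using norm_A(1)[of a] \<open>r > 0\<close> by (cases "na a = 0") (auto simp: power2_eq_square)
  then show "na (star b \<boxtimes> b) \<le> na (star b \<boxtimes> b \<boxplus> (star c \<boxtimes> c \<boxplus> star d \<boxtimes> d)) + \<epsilon>"
    by (simp add: a_def r_def s_def)
qed

lemma ip_sum_eq_0:
  assumes "ip u u \<boxplus> ip v v = ca_zero A" shows "u = \<zero>" "v = \<zero>"
proof -
  have *: "u = \<zero>" if uv: "ip u u \<boxplus> ip v v = ca_zero A" for u v
  proof -
    obtain b c where bc: "ip u u = star b \<boxtimes> b" "ip v v = star c \<boxtimes> c"
      using ip_pos unfolding ca_pos_def by metis
    have "star (ca_zero A) \<boxtimes> ca_zero A = ca_zero A"
      by (metis star_A(5) norm_A(2) zero_eq_power2)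
    then have "na (ip u u) \<le> 0"
      using norm_le_norm_sum_squares[of b c "ca_zero A"] uv norm_A(2)[of "ca_zero A"] by (simp add: bc)
    then show ?thesis
      using norm_A(1,2)[of "ip u u"] ip_self_zero[of u] by simp
  qed
  show "u = \<zero>" "v = \<zero>"
    using *[OF assms] *[of v u] assms by (simp_all add: alg.add.commute)
qed

text \<open>With \<open>m = ip x y\<close>, \<open>a = ip x x\<close>, \<open>r = na a\<close> and \<open>w = r y - x m\<close> one has
  \<open>r\<^sup>2 ip y y = r m* m + m* (r - a) m + ip w w\<close>, a sum of three squares.\<close>
lemma na_ip_le: "na (ip x y) \<le> nm x * nm y"
proof (cases "x = \<zero>")
  case True
  then show ?thesis using norm_A(2)[of "ca_zero A"] by simp
next
  case False
  define m where "m = ip x y"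
  define a where "a = ip x x"
  define r where "r = na a"
  have r: "r > 0"
    using False ip_self_zero[of x] norm_A(1,2)[of a] by (auto simp: r_def a_def less_le)
  have star_a: "star a = a"
    by (simp add: a_def ip_star)
  have "self_sa (ca_mult A a)"
    using self_module_adjp[of a] by (simp add: star_a)
  then have "self_sa (\<lambda>z. ca_smul A (of_real r) z \<boxminus> a \<boxtimes> z)"
    using hilb_module.adjp_diff[OF self_module_hilb_module hilb_module.sa_smul_id[OF self_module_hilb_module, of r]] by (simp add: self_module_simps)
  moreover have "na (ca_smul A (of_real r) z \<boxminus> (ca_smul A (of_real r) z \<boxminus> a \<boxtimes> z)) \<le> r * na z" for z
    using mult_A(6)[of a z] by (simp add: r_def alg.diff_diff_eq2)
  ultimately have "self_pos (\<lambda>z. ca_smul A (of_real r) z \<boxminus> a \<boxtimes> z)"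
    using hilb_module_cs.pos_opI[OF self_module_cs _ r] by (simp add: self_module_simps self_module_norm)
  \<comment> \<open>Without a unit \<open>r - a\<close> need not belong to the algebra. Its root is
    therefore an operator on the self-module, and the square that enters the sum is formed from the
    element \<open>k m\<close>.\<close>
  then obtain k where k: "self_sa k" "\<And>z. k (k z) = ca_smul A (of_real r) z \<boxminus> a \<boxtimes> z"
    unfolding hilb_module_cs.pos_op_def[OF self_module_cs] by metis
  define w where "w = of_real r \<cdot> y \<ominus> hm_act H x m"
  obtain d where d: "ip w w = star d \<boxtimes> d"
    using ip_pos unfolding ca_pos_def by metis
  define b where "b = ca_smul A (of_real (sqrt r)) m"
  have b: "star b \<boxtimes> b = ca_smul A (of_real r) (star m \<boxtimes> m)"
    using r by (simp add: b_def mult_A flip: of_real_mult)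
  have c: "star (k m) \<boxtimes> k m = ca_smul A (of_real r) (star m \<boxtimes> m) \<boxminus> star m \<boxtimes> (a \<boxtimes> m)"
  proof -
    have "star (k m) \<boxtimes> k m = star m \<boxtimes> k (k m)"
      using hilb_module.adjpD[OF self_module_hilb_module k(1), of m "k m"] by (simp add: self_module_simps)
    then show ?thesis
      by (simp add: k(2) mult_diff_A mult_A)
  qed
  have "star m = ip y x"
    by (simp add: m_def ip_star)
  then have d': "star d \<boxtimes> d = ca_smul A (of_real (r * r)) (ip y y)
      \<boxminus> ca_smul A (of_real r) (star m \<boxtimes> m) \<boxminus> (ca_smul A (of_real r) (star m \<boxtimes> m) \<boxminus> star m \<boxtimes> (a \<boxtimes> m))"
    unfolding d[symmetric] w_def
    by (simp add: ip_simps ip_act_left ip_act_right mult_A mult_diff_A asmul_diff_right flip: m_def a_def)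
  have "star b \<boxtimes> b \<boxplus> (star (k m) \<boxtimes> k m \<boxplus> star d \<boxtimes> d) = ca_smul A (of_real (r * r)) (ip y y)"
    unfolding b c d' alg.diff_diff_add alg.add.assoc[symmetric] alg.add_diff_eq
    by (rule alg.add_diff_cancel_left')
  then have "na (star b \<boxtimes> b) \<le> r * r * na (ip y y)"
    using norm_le_norm_sum_squares[of b "k m" d] r by (simp add: norm_A norm_mult)
  then have "r * (na m)\<^sup>2 \<le> r * (r * na (ip y y))"
    using r unfolding b by (simp add: norm_A)
  then have "(na m)\<^sup>2 \<le> (nm x * nm y)\<^sup>2"
    using r by (simp add: power_mult_distrib nm_sq r_def a_def)
  then show ?thesis
    unfolding m_def by (rule power2_le_imp_le) simp
qed

end

lemma hilb_module_csI: "hilbert_module A H \<Longrightarrow> hilb_module_cs A H"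
  by (simp add: hilb_module_cs_def hilb_module_def hilb_module_cs_axioms_def hilb_module.na_ip_le)

subsection \<open>Limits, closures and projections\<close>

context hilb_module_cs
begin

abbreviation cl where "cl \<equiv> hm_closure A H"

definition conv where "conv X l \<longleftrightarrow> (\<lambda>n. nm (X n \<ominus> l)) \<longlonglongrightarrow> 0"

lemma conv_bound:
  assumes "\<And>n. nm (X n \<ominus> l) \<le> f n" "f \<longlonglongrightarrow> 0" shows "conv X l"
  unfolding conv_def by (rule tendsto_sandwich[OF _ _ tendsto_const assms(2)]) (simp_all add: assms(1))

lemma conv_const: "conv (\<lambda>_. l) l"
  by (simp add: conv_def)

lemma conv_unique:
  assumes "conv X l" "conv X l'" shows "l = l'"
proof (rule eq_by_limit)
  show "nm (l \<ominus> l') \<le> nm (X n \<ominus> l) + nm (X n \<ominus> l')" for n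
    using nm_diff_le[of l l' "X n"] nm_minus_commute[of l "X n"] by simp
  show "(\<lambda>n. nm (X n \<ominus> l) + nm (X n \<ominus> l')) \<longlonglongrightarrow> 0"
    using assms tendsto_add[of _ 0 _ _ 0] unfolding conv_def by simp
qed

lemma conv_diff:
  assumes "conv X l" "conv Y k" shows "conv (\<lambda>n. X n \<ominus> Y n) (l \<ominus> k)"
proof (rule conv_bound)
  fix n
  have "X n \<ominus> Y n \<ominus> (l \<ominus> k) = (X n \<ominus> l) \<ominus> (Y n \<ominus> k)"
    by (simp add: vec.diff_diff_eq2 vec.diff_diff_add vec.diff_add_eq vec.add_diff_eq vec.add_ac)
  then show "nm (X n \<ominus> Y n \<ominus> (l \<ominus> k)) \<le> nm (X n \<ominus> l) + nm (Y n \<ominus> k)"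
    using nm_triangle_diff by simp
next
  show "(\<lambda>n. nm (X n \<ominus> l) + nm (Y n \<ominus> k)) \<longlonglongrightarrow> 0"
    using assms tendsto_add[of _ 0 _ _ 0] unfolding conv_def by simp
qed

lemma conv_adjp:
  assumes T: "adjp T S" and X: "conv X l" shows "conv (\<lambda>n. T (X n)) (T l)"
proof -
  obtain C where C: "\<And>x. nm (T x) \<le> C * nm x"
    using adjp_bounded[OF T] by blast
  show ?thesis
  proof (rule conv_bound)
    show "nm (T (X n) \<ominus> T l) \<le> C * nm (X n \<ominus> l)" for n
      using C[of "X n \<ominus> l"] by (simp add: adjp_linear[OF T])
    show "(\<lambda>n. C * nm (X n \<ominus> l)) \<longlonglongrightarrow> 0"
      using X tendsto_mult_right_zero unfolding conv_def by blast
  qed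
qed

text \<open>Joint continuity of the inner product, stated for two pairs of sequences so that an
  isometry identity on a dense set passes to limits.\<close>

lemma conv_ip_eq:
  assumes eq: "\<And>n. ip (X n) (Y n) = ip (X' n) (Y' n)"
    and conv: "conv X x" "conv Y y" "conv X' x'" "conv Y' y'"
  shows "ip x y = ip x' y'"
proof -
  have step: "na (ip x y \<boxminus> ip (X n) (Y n)) \<le> nm x * nm (Y n \<ominus> y) + nm (X n \<ominus> x) * (nm y + nm (Y n \<ominus> y))"
    for X Y x y n
  proof -
    have "ip x y \<boxminus> ip (X n) (Y n) = ip x (y \<ominus> Y n) \<boxplus> ip (x \<ominus> X n) (Y n)"
      by (simp add: ip_simps alg.add_diff_eq)
    also have "na \<dots> \<le> nm x * nm (Y n \<ominus> y) + nm (X n \<ominus> x) * nm (Y n)"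
      unfolding nm_minus_commute[of "Y n" y] nm_minus_commute[of "X n" x]
      by (intro order_trans[OF norm_A(4)] add_mono cauchy_schwarz)
    also have "\<dots> \<le> nm x * nm (Y n \<ominus> y) + nm (X n \<ominus> x) * (nm y + nm (Y n \<ominus> y))"
      by (intro add_left_mono mult_left_mono nm_le_add_diff) simp
    finally show ?thesis .
  qed
  define f where "f X Y x y n = nm x * nm (Y n \<ominus> y) + nm (X n \<ominus> x) * (nm y + nm (Y n \<ominus> y))"
    for X Y :: "nat \<Rightarrow> 'b" and x y n
  have f_lim: "f X Y x y \<longlonglongrightarrow> 0" if "conv X x" "conv Y y" for X Y x y
    using that unfolding f_def conv_def by (auto intro!: tendsto_eq_intros)
  show ?thesis
  proof (rule eq_by_limit_A)
    fix n
    have "ip x y \<boxminus> ip x' y' = (ip x y \<boxminus> ip (X n) (Y n)) \<boxplus> (ip (X' n) (Y' n) \<boxminus> ip x' y')"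
      by (simp add: eq alg.add_diff_eq)
    also have "na \<dots> \<le> na (ip x y \<boxminus> ip (X n) (Y n)) + na (ip x' y' \<boxminus> ip (X' n) (Y' n))"
      using norm_A(4)[of "ip x y \<boxminus> ip (X n) (Y n)" "ip (X' n) (Y' n) \<boxminus> ip x' y'"]
        norm_A(3)[of "-1" "ip x' y' \<boxminus> ip (X' n) (Y' n)"] by simp
    also have "\<dots> \<le> f X Y x y n + f X' Y' x' y' n"
      unfolding f_def by (intro add_mono step)
    finally show "na (ip x y \<boxminus> ip x' y') \<le> f X Y x y n + f X' Y' x' y' n" .
  next
    show "(\<lambda>n. f X Y x y n + f X' Y' x' y' n) \<longlonglongrightarrow> 0"
      using tendsto_add[OF f_lim[OF conv(1,2)] f_lim[OF conv(3,4)]] by simp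
  qed
qed

text \<open>Serves to extend an isometry from a dense set: the images of a convergent sequence are
  Cauchy, and the module is complete.\<close>

lemma conv_of_Cauchy_dist:
  assumes X: "conv X x" and le: "\<And>m n. nm (Y m \<ominus> Y n) \<le> nm (X m \<ominus> X n)"
  shows "\<exists>y. conv Y y"
  unfolding conv_def
proof (rule complete_H)
  fix e :: real assume "e > 0"
  then obtain N where N: "\<And>n. n \<ge> N \<Longrightarrow> nm (X n \<ominus> x) < e / 2"
    using LIMSEQ_D[OF X[unfolded conv_def], of "e / 2"] by auto
  have "nm (Y m \<ominus> Y n) < e" if "m \<ge> N" "n \<ge> N" for m n
    using le[of m n] nm_diff_le[of "X m" "X n" x] N[OF that(1)] N[OF that(2)]
      nm_minus_commute[of x "X n"] by simp
  then show "\<exists>N. \<forall>m\<ge>N. \<forall>n\<ge>N. nm (Y m \<ominus> Y n) < e"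
    by (intro exI[of _ N]) simp
qed

lemma closure_seq: "x \<in> cl S \<longleftrightarrow> (\<exists>X. (\<forall>n. X n \<in> S) \<and> conv X x)"
  by (simp add: hm_closure_def conv_def)

lemma closureI:
  assumes "\<And>e. e > 0 \<Longrightarrow> \<exists>y\<in>S. nm (y \<ominus> x) < e" shows "x \<in> cl S"
proof -
  have "\<exists>y. y \<in> S \<and> nm (y \<ominus> x) < inverse (real (Suc n))" for n
    using assms[of "inverse (real (Suc n))"] by auto
  then obtain X where X: "\<And>n. X n \<in> S" "\<And>n. nm (X n \<ominus> x) < inverse (real (Suc n))"
    by metis
  have "conv X x"
    by (rule conv_bound[OF _ LIMSEQ_inverse_real_of_nat]) (use X(2) in \<open>simp add: less_imp_le\<close>)
  then show ?thesis
    using X closure_seq by blast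
qed

lemma closureD:
  assumes "x \<in> cl S" "e > 0" shows "\<exists>y\<in>S. nm (y \<ominus> x) < e"
proof -
  obtain X where X: "\<And>n. X n \<in> S" "conv X x"
    using assms(1) closure_seq by blast
  obtain n where "nm (X n \<ominus> x) < e"
    using LIMSEQ_D[OF X(2)[unfolded conv_def] assms(2)] by auto
  then show ?thesis
    using X by blast
qed

lemma closure_subset: "S \<subseteq> cl S"
proof
  fix x assume "x \<in> S"
  then show "x \<in> cl S"
    unfolding closure_seq by (intro exI[of _ "\<lambda>_. x"]) (simp add: conv_const)
qed

lemma closure_minimal:
  assumes "S \<subseteq> cl M" shows "cl S \<subseteq> cl M"
proof
  fix x assume x: "x \<in> cl S"
  show "x \<in> cl M"
  proof (rule closureI)
    fix e :: real assume "e > 0"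
    then obtain y where y: "y \<in> S" "nm (y \<ominus> x) < e / 2"
      using closureD[OF x, of "e / 2"] by auto
    then obtain z where z: "z \<in> M" "nm (z \<ominus> y) < e / 2"
      using closureD[of y M "e / 2"] assms \<open>e > 0\<close> by auto
    have "nm (z \<ominus> x) < e"
      using nm_diff_le[of z x y] y z by simp
    then show "\<exists>y\<in>M. nm (y \<ominus> x) < e"
      using z by blast
  qed
qed

lemma closure_zero: "cl {\<zero>} = {\<zero>}"
proof
  show "cl {\<zero>} \<subseteq> {\<zero>}"
  proof
    fix x assume "x \<in> cl {\<zero>}"
    then obtain X where "\<And>n. X n = \<zero>" "conv X x"
      unfolding closure_seq by auto
    moreover from this have "X = (\<lambda>_. \<zero>)" by blast
    ultimately show "x \<in> {\<zero>}"
      using conv_unique[OF conv_const, of \<zero> x] by simp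
  qed
qed (rule closure_subset)

definition subsp where "subsp M \<longleftrightarrow> \<zero> \<in> M \<and> (\<forall>x\<in>M. \<forall>y\<in>M. x \<ominus> y \<in> M)"

lemma subspD: "subsp M \<Longrightarrow> x \<in> M \<Longrightarrow> y \<in> M \<Longrightarrow> x \<ominus> y \<in> M" "subsp M \<Longrightarrow> \<zero> \<in> M"
  by (auto simp: subsp_def)

lemma subsp_add: assumes "subsp M" "x \<in> M" "y \<in> M" shows "x \<oplus> y \<in> M"
proof -
  have "x \<ominus> (\<zero> \<ominus> y) \<in> M"
    by (intro subspD assms)
  then show ?thesis by simp
qed

lemma subsp_range: assumes "adjp T S" shows "subsp (range T)"
  unfolding subsp_def
proof (intro conjI ballI)
  show "\<zero> \<in> range T"
    using rangeI[of T \<zero>] adjp_linear(4)[OF assms] by simp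
  fix x y assume "x \<in> range T" "y \<in> range T"
  then show "x \<ominus> y \<in> range T"
    by (auto simp flip: adjp_linear(2)[OF assms])
qed

lemma subsp_closure: assumes "subsp M" shows "subsp (cl M)"
  unfolding subsp_def
proof (intro conjI ballI)
  show "\<zero> \<in> cl M"
    using closure_subset subspD(2)[OF assms] by blast
  fix x y assume "x \<in> cl M" "y \<in> cl M"
  then obtain X Y where "\<And>n. X n \<in> M" "conv X x" "\<And>n. Y n \<in> M" "conv Y y"
    unfolding closure_seq by blast
  then show "x \<ominus> y \<in> cl M"
    unfolding closure_seq by (intro exI[of _ "\<lambda>n. X n \<ominus> Y n"]) (auto intro: conv_diff subspD assms)
qed

lemma in_orth: "y \<in> orth H M \<longleftrightarrow> (\<forall>x\<in>M. ip x y = ca_zero A)"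
  by (simp add: orth_def)

lemma closure_orth: assumes "\<And>x. x \<in> S \<Longrightarrow> ip x y = ca_zero A" "x \<in> cl S" shows "ip x y = ca_zero A"
proof -
  obtain X where X: "\<And>n. X n \<in> S" "conv X x"
    using assms(2) closure_seq by blast
  have "ip x y = ip \<zero> y"
    by (rule conv_ip_eq[OF _ X(2) conv_const conv_const conv_const]) (simp add: assms(1) X(1))
  then show ?thesis by simp
qed

lemma orth_proj_eq:
  assumes M: "subsp M" and u: "u \<in> M" "x \<ominus> u \<in> orth H M"
  shows "orth_proj H M x = u"
  unfolding orth_proj_def
proof (rule the_equality)
  fix m assume m: "m \<in> M \<and> x \<ominus> m \<in> orth H M"
  have "ip (m \<ominus> u) ((x \<ominus> u) \<ominus> (x \<ominus> m)) = ca_zero A"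
    using u m subspD(1)[OF M, of m u] by (simp add: in_orth ip_diff_right[of "m \<ominus> u" "x \<ominus> u" "x \<ominus> m"])
  moreover have "(x \<ominus> u) \<ominus> (x \<ominus> m) = m \<ominus> u"
    by (simp add: vec.diff_diff_eq2 vec.diff_add_eq vec.diff_diff_add vec.add.commute[of u])
  ultimately show "m = u"
    using ip_self_zero[of "m \<ominus> u"] by simp
qed (use u in simp)

lemma orth_proj_complemented:
  assumes M: "subsp M" "orth_complemented H M"
  shows "orth_proj H M x \<in> M" "x \<ominus> orth_proj H M x \<in> orth H M" "x \<in> M \<Longrightarrow> orth_proj H M x = x"
    "sa (orth_proj H M)"
proof -
  have *: "orth_proj H M x \<in> M \<and> x \<ominus> orth_proj H M x \<in> orth H M" for x
  proof -
    obtain m k where mk: "m \<in> M" "k \<in> orth H M" "x = m \<oplus> k"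
      using M(2) unfolding orth_complemented_def by metis
    then have "orth_proj H M x = m"
      by (intro orth_proj_eq M) auto
    then show ?thesis using mk by simp
  qed
  then show "orth_proj H M x \<in> M" "x \<ominus> orth_proj H M x \<in> orth H M" by auto
  show "orth_proj H M x = x" if "x \<in> M"
    using that by (intro orth_proj_eq M) (auto simp: in_orth)
  have right: "ip (orth_proj H M x) y = ip (orth_proj H M x) (orth_proj H M y)" for x y
    using *[of x] *[of y] by (auto simp: in_orth ip_diff_right)
  then have "ip (orth_proj H M x) y = ip x (orth_proj H M y)" for x y
    by (metis ip_star)
  then show "sa (orth_proj H M)"
    by (simp add: adjp_def)
qed

lemma adjointable_adjp: "adjointable H T \<Longrightarrow> adjp T (adj H T)"
  unfolding adjointable_def adj_def adjp_def
  by (rule someI_ex[where P = "\<lambda>S. \<forall>x y. ip (T x) y = ip x (S y)"])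

lemma adjp_zero_iff:
  assumes "adjp T S" shows "(\<forall>x. T x = \<zero>) \<longleftrightarrow> (\<forall>x. S x = \<zero>)"
  using adjp_zero_of_comp[OF assms] adjp_zero_of_comp[OF adjp_sym[OF assms]] adjp_linear(4)[OF assms]
    adjp_linear(4)[OF adjp_sym[OF assms]] by metis

lemma closure_range_zero_iff: "cl (range T) = {\<zero>} \<longleftrightarrow> (\<forall>x. T x = \<zero>)"
proof
  assume "cl (range T) = {\<zero>}"
  then show "\<forall>x. T x = \<zero>"
    using closure_subset[of "range T"] by blast
next
  assume "\<forall>x. T x = \<zero>"
  then have "range T = {\<zero>}" by auto
  then show "cl (range T) = {\<zero>}" using closure_zero by simp
qed

end

subsection \<open>Harmonious quasi-projection pairs\<close>

locale harmonious_pair = hilb_module_cs +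
  fixes P Q :: "'b \<Rightarrow> 'b"
  assumes harmonious: "harmonious A H P Q"
begin

abbreviation N where "N \<equiv> (\<lambda>x. x \<ominus> P x)"
abbreviation R where "R \<equiv> refl_op H P"
abbreviation K where "K \<equiv> H5 A H P Q"
abbreviation L where "L \<equiv> H6 A H P Q"

definition opA where "opA x = P (Q (P x))"
definition opB where "opB x = P (Q (N x))"
definition opC where "opC x = N (Q (P x))"
definition opD where "opD x = N (Q (N x))"

lemma qpp: "quasi_projection_pair H P Q" "orth_complemented H K" "orth_complemented H L"
  using harmonious unfolding harmonious_def by blast+

lemma sa_P: "sa P"
  using qpp(1) adjointable_adjp[of P] unfolding quasi_projection_pair_def is_projection_def by metis

lemma PP [simp]: "P (P x) = P x"
  using qpp(1) unfolding quasi_projection_pair_def is_projection_def by (metis comp_apply)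

lemma QQ [simp]: "Q (Q x) = Q x"
  using qpp(1) unfolding quasi_projection_pair_def is_idempotent_def by (metis comp_apply)

lemma adj_Q: "adj H Q = (\<lambda>x. R (Q (R x)))"
  using qpp(1) unfolding quasi_projection_pair_def by (simp add: comp_def)

lemma adjp_Q: "adjp Q (\<lambda>x. R (Q (R x)))"
  using qpp(1) adjointable_adjp[of Q] unfolding quasi_projection_pair_def is_idempotent_def adj_Q by blast

lemmas linP = adjp_linear[OF sa_P] and linQ = adjp_linear[OF adjp_Q]

lemma sa_N: "sa N"
  by (rule adjp_diff[OF adjp_id sa_P])

lemma PN [simp]: "P (x \<ominus> P x) = \<zero>"
  by (simp add: linP)

lemma R_P: "R (P x) = P x" and R_N: "R (N x) = (-1) \<cdot> N x"
  and P_R: "P (R x) = P x" and N_R: "N (R x) = (-1) \<cdot> N x"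
  by (simp_all add: refl_op_def linP vec.diff_diff_add vec.add.commute[of x])

text \<open>In \<open>Q* = R Q R\<close> the reflection is 1 on the range of \<open>P\<close> and -1
  on that of \<open>N\<close>. The signs cancel in the diagonal corners, while exactly one survives
  in an off-diagonal corner.\<close>

lemma sa_opA: "sa opA" and sa_opD: "sa opD" and adjp_opB: "adjp opB (\<lambda>x. (-1) \<cdot> opC x)"
proof -
  have "adjp (\<lambda>x. P (Q (P x))) (\<lambda>x. P (R (Q (R (P x)))))"
    using adjp_comp[OF sa_P adjp_comp[OF adjp_Q sa_P]] .
  then show "sa opA"
    unfolding R_P P_R by (simp add: opA_def[abs_def])
  have "adjp (\<lambda>x. N (Q (N x))) (\<lambda>x. N (R (Q (R (N x)))))"
    using adjp_comp[OF sa_N adjp_comp[OF adjp_Q sa_N]] .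
  then show "sa opD"
    unfolding R_N N_R by (simp add: opD_def[abs_def] linQ linP smul_diff_right)
  have "adjp (\<lambda>x. P (Q (N x))) (\<lambda>x. N (R (Q (R (P x)))))"
    using adjp_comp[OF sa_P adjp_comp[OF adjp_Q sa_N]] .
  then show "adjp opB (\<lambda>x. (-1) \<cdot> opC x)"
    unfolding R_P N_R by (simp add: opB_def[abs_def] opC_def)
qed

lemma adjp_opC: "adjp opC (\<lambda>x. (-1) \<cdot> opB x)"
  using adjp_smul[OF adjp_sym[OF adjp_opB], of "-1"] by simp

lemmas linA = adjp_linear[OF sa_opA] and linB = adjp_linear[OF adjp_opB]
  and linC = adjp_linear[OF adjp_opC] and linD = adjp_linear[OF sa_opD]

lemma Q_P: "Q (P x) = opA x \<oplus> opC x" and Q_N: "Q (N x) = opB x \<oplus> opD x"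
  by (simp_all add: opA_def opB_def opC_def opD_def)

lemma P_op [simp]: "P (opA x) = opA x" "P (opB x) = opB x" "P (opC x) = \<zero>" "P (opD x) = \<zero>"
  by (simp_all add: opA_def opB_def opC_def opD_def)

lemma AA_BC: "opA (opA x) \<oplus> opB (opC x) = opA x"
  and CA_DC: "opC (opA x) \<oplus> opD (opC x) = opC x"
proof -
  have "Q (opA x) \<oplus> Q (opC x) = Q (P x)"
    using QQ[of "P x"] by (simp only: Q_P linQ)
  moreover have "Q (opA x) = opA (opA x) \<oplus> opC (opA x)"
    using Q_P[of "opA x"] by simp
  moreover have "Q (opC x) = opB (opC x) \<oplus> opD (opC x)"
    using Q_N[of "opC x"] by simp
  ultimately have *: "(opA (opA x) \<oplus> opC (opA x)) \<oplus> (opB (opC x) \<oplus> opD (opC x)) = opA x \<oplus> opC x"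
    by (simp only: Q_P)
  show AA: "opA (opA x) \<oplus> opB (opC x) = opA x"
    using arg_cong[OF *, of P] by (simp add: linP)
  have "(opA (opA x) \<oplus> opB (opC x)) \<oplus> (opC (opA x) \<oplus> opD (opC x)) = opA x \<oplus> opC x"
    unfolding *[symmetric] by (simp only: vec.add_ac)
  then show "opC (opA x) \<oplus> opD (opC x) = opC x"
    unfolding AA by simp
qed

lemma AB_BD: "opA (opB x) \<oplus> opB (opD x) = opB x"
proof -
  have "Q (opB x) \<oplus> Q (opD x) = Q (N x)"
    using QQ[of "N x"] unfolding Q_N linQ(1) .
  moreover have "Q (opB x) = opA (opB x) \<oplus> opC (opB x)"
    using Q_P[of "opB x"] by simp
  moreover have "Q (opD x) = opB (opD x) \<oplus> opD (opD x)"
    using Q_N[of "opD x"] by simp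
  ultimately have *: "(opA (opB x) \<oplus> opC (opB x)) \<oplus> (opB (opD x) \<oplus> opD (opD x)) = opB x \<oplus> opD x"
    by (simp only: Q_N)
  show ?thesis
    using arg_cong[OF *, of P] by (simp add: linP)
qed

lemma K_eq: "K = cl (range opB)" and L_eq: "L = cl (range opC)"
  by (simp_all add: H5_def H6_def opB_def[abs_def] opC_def[abs_def] comp_def)

lemma subsp_K: "subsp K" and subsp_L: "subsp L"
  unfolding K_eq L_eq by (intro subsp_closure subsp_range, rule adjp_opB adjp_opC)+

lemma opB_in_K: "opB x \<in> K" and opC_in_L: "opC x \<in> L"
  unfolding K_eq L_eq by (rule subsetD[OF closure_subset rangeI])+

lemma closure_K: "cl K = K"
  unfolding K_eq by (intro subset_antisym closure_minimal closure_subset order_refl)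

lemma P_K: "x \<in> K \<Longrightarrow> P x = x" and P_L: "x \<in> L \<Longrightarrow> P x = \<zero>"
proof -
  assume "x \<in> K"
  then obtain X where X: "\<And>n. X n \<in> range opB" "conv X x"
    unfolding K_eq closure_seq by blast
  have "P (X n) = X n" for n
    using X(1)[of n] by auto
  then show "P x = x"
    using conv_unique[OF conv_adjp[OF sa_P X(2)]] X(2) by simp
next
  assume "x \<in> L"
  then obtain X where X: "\<And>n. X n \<in> range opC" "conv X x"
    unfolding L_eq closure_seq by blast
  have "P (X n) = \<zero>" for n
    using X(1)[of n] by auto
  then show "P x = \<zero>"
    using conv_unique[OF conv_adjp[OF sa_P X(2)]] conv_const by simp
qed

text \<open>By \<open>AB_BD\<close>, \<open>a b = b (1 - d)\<close>, so \<open>opA\<close> maps the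
  range of \<open>opB\<close> into itself, and by continuity also its closure.\<close>

lemma opA_in_K: assumes "x \<in> K" shows "opA x \<in> K"
proof -
  obtain X where X: "\<And>n. X n \<in> range opB" "conv X x"
    using assms unfolding K_eq closure_seq by blast
  have "opA (opB z) \<in> range opB" for z
  proof -
    have "opA (opB z) = opB (z \<ominus> opD z)"
      using AB_BD[of z] by (simp add: linB vec.eq_diff_eq)
    then show ?thesis by blast
  qed
  then have "opA (X n) \<in> range opB" for n
    using X(1)[of n] by auto
  then show ?thesis
    unfolding K_eq closure_seq
    by (intro exI[of _ "\<lambda>n. opA (X n)"] conjI allI conv_adjp[OF sa_opA X(2)])
qed

abbreviation P5 where "P5 \<equiv> orth_proj H K"

lemmas P5 = orth_proj_complemented[OF subsp_K qpp(2)]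

text \<open>Minus \<open>opC\<close> is the adjoint of \<open>opB\<close>, so it vanishes on the
  orthogonal complement of the range of \<open>opB\<close>.\<close>

lemma opC_P5: "opC (P5 x) = opC x"
proof -
  have "(-1) \<cdot> opC (x \<ominus> P5 x) = \<zero>"
  proof (rule ip_eqI)
    show "ip y ((-1) \<cdot> opC (x \<ominus> P5 x)) = ip y \<zero>" for y
      using P5(2)[of x] opB_in_K[of y] adjpD[OF adjp_opB, of y "x \<ominus> P5 x"] by (simp add: in_orth)
  qed
  then show ?thesis by (simp add: linC)
qed

section \<open>The square root of \<open>a\<^sup>2 - a\<close> on \<open>H5\<close>\<close>

definition opT where "opT x = opA (opA x) \<ominus> opA x"

lemma opT_eq: "opT x = opB ((-1) \<cdot> opC x)"
  using AA_BC[of x] unfolding opT_def linB(3) by (metis vec.add_diff_cancel_left' vec.diff_diff_add vec.diff_self vec.diff_0)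

lemma pos_opT: "pos_op opT"
  using pos_op_adjp_comp[OF adjp_sym[OF adjp_opB]] unfolding opT_eq[symmetric] .

text \<open>The root is taken on all of \<open>H\<close>, where the operator theory applies;
  \<open>ell\<close> turns out to be its restriction to \<open>K\<close>, extended by zero.\<close>

definition rt where "rt = (SOME S. is_sqrt opT S)"

lemma rt: "is_sqrt opT rt"
  unfolding rt_def by (rule someI_ex[OF pos_op_sqrt[OF pos_opT]])

lemmas sa_rt = is_sqrtD(1)[OF rt] and rt_rt = is_sqrtD(3)[OF rt]

lemma opT_in_K: "opT x \<in> K"
  unfolding opT_eq by (rule opB_in_K)

lemma opT_P5: "opT (P5 x) = opT x" and P5_opT: "P5 (opT x) = opT x"
  by (simp_all add: opT_eq opC_P5 P5(3) opB_in_K)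

lemma rt_opA: "rt (opA x) = opA (rt x)"
  by (rule is_sqrtD(4)[OF rt sa_opA, symmetric]) (simp add: opT_def linA)

text \<open>\<open>opT\<close> commutes with the projection onto \<open>K\<close>, hence so does its
  root, which therefore maps \<open>K\<close> into itself.\<close>

lemma rt_P5: "P5 (rt x) = rt (P5 x)"
  by (rule is_sqrtD(4)[OF rt P5(4)]) (simp add: opT_P5 P5_opT)

lemma rt_in_K: "x \<in> K \<Longrightarrow> rt x \<in> K"
  by (metis P5(1,3) rt_P5)

text \<open>Needed because \<open>positive_on\<close> asks for factors that preserve
  \<open>K\<close>: a root of \<open>rt\<close> inherits commutation with the projection onto
  \<open>K\<close>.\<close>

lemma ex_rt_rt: "\<exists>r. sa r \<and> (\<forall>x. r (r x) = rt x) \<and> r ` K \<subseteq> K"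
proof -
  obtain r where r: "is_sqrt rt r"
    using pos_op_sqrt[OF is_sqrtD(2)[OF rt]] by blast
  have "P5 (r x) = r (P5 x)" for x
    by (rule is_sqrtD(4)[OF r P5(4)]) (rule rt_P5)
  then have "r ` K \<subseteq> K"
    by (metis P5(1,3) image_subsetI)
  then show ?thesis
    using is_sqrtD(1,3)[OF r] by blast
qed

lemma positive_on_rt: "positive_on H K (\<lambda>x. if x \<in> K then rt x else \<zero>)"
proof -
  obtain r where r: "sa r" "\<And>x. r (r x) = rt x" "r ` K \<subseteq> K"
    using ex_rt_rt by blast
  show ?thesis
    unfolding positive_on_def
    by (intro conjI exI[of _ r]) (use r rt_in_K in \<open>auto simp: adjpD\<close>)
qed

text \<open>Uniqueness of the positive square root: \<open>F\<close> commutes with \<open>opT\<close>, hence with \<open>rt\<close>, and so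
  \<open>u = rt x - F x\<close> satisfies \<open>rt u + F u = 0\<close>.\<close>
lemma positive_sqrt_unique:
  assumes pos: "positive_on H K F" and FF: "\<And>x. x \<in> K \<Longrightarrow> F (F x) = opT x" and x: "x \<in> K"
  shows "F x = rt x"
proof -
  obtain B Bs where B: "B ` K \<subseteq> K" "Bs ` K \<subseteq> K" "\<forall>x\<in>K. F x = Bs (B x)"
    "\<forall>x\<in>K. \<forall>y\<in>K. ip (B x) y = ip x (Bs y)"
    using pos unfolding positive_on_def by (elim conjE exE) (rule that)
  have FK: "F x \<in> K" if "x \<in> K" for x
    using B(1,2,3) that by auto
  have ipF: "ip x (F y) = ip (B x) (B y)" if "x \<in> K" "y \<in> K" for x y
    using B(1,3,4) that by auto
  have F_sa: "ip (F x) y = ip x (F y)" if "x \<in> K" "y \<in> K" for x y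
    using ipF[OF that] ipF[OF that(2,1)] ip_star by metis
  \<comment> \<open>Nothing is known about \<open>F\<close> off \<open>K\<close>. Through the
    projection it becomes a self-adjoint operator on \<open>H\<close>, to which the bicommutant
    property of \<open>rt\<close> applies.\<close>
  define G where "G = (\<lambda>x. F (P5 x))"
  have GK: "G x = F x" if "x \<in> K" for x
    using that by (simp add: G_def P5(3))
  have "sa G"
    unfolding adjp_def
  proof (intro allI)
    fix x y
    have "ip (G x) y = ip (P5 (G x)) y"
      by (simp add: G_def P5(1,3) FK)
    also have "\<dots> = ip (F (P5 x)) (P5 y)"
      by (simp add: adjpD[OF P5(4)] G_def)
    also have "\<dots> = ip (P5 x) (F (P5 y))"
      by (simp add: F_sa P5(1))
    also have "\<dots> = ip x (P5 (G y))"
      by (simp add: adjpD[OF P5(4)] G_def)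
    also have "\<dots> = ip x (G y)"
      by (simp add: G_def P5(1,3) FK)
    finally show "ip (G x) y = ip x (G y)" .
  qed
  moreover have "G (opT x) = opT (G x)" for x
  proof -
    have "G (opT x) = F (opT (P5 x))"
      by (simp add: GK opT_in_K opT_P5)
    also have "\<dots> = F (F (G x))"
      by (simp only: G_def FF[OF P5(1)])
    also have "\<dots> = opT (G x)"
      by (rule FF) (simp add: G_def P5(1) FK)
    finally show ?thesis .
  qed
  ultimately have G_rt: "G (rt x) = rt (G x)" for x
    by (rule is_sqrtD(4)[OF rt])
  note linG = adjp_linear[OF \<open>sa G\<close>]
  obtain r where r: "sa r" "\<And>x. r (r x) = rt x"
    using ex_rt_rt by blast
  define u where "u = rt x \<ominus> G x"
  have u: "u \<in> K"
    unfolding u_def using x by (intro subspD subsp_K rt_in_K) (simp_all add: GK FK)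
  \<comment> \<open>As \<open>rt\<close> and \<open>G\<close> commute,
    \<open>(rt + G) (rt - G)\<close> is the difference of their squares, and both squares give
    \<open>opT x\<close>.\<close>
  have sum0: "rt u \<oplus> G u = \<zero>"
  proof -
    have "G (G x) = opT x"
      using x by (simp add: GK FK FF)
    then show ?thesis
      by (simp add: u_def adjp_linear[OF sa_rt] linG rt_rt G_rt vec.add_diff_eq)
  qed
  \<comment> \<open>Testing \<open>sum0\<close> against \<open>u\<close> writes zero as a sum of two
    positive elements, so each of them vanishes.\<close>
  have "ip (r u) (r u) \<boxplus> ip (B u) (B u) = ip u (rt u \<oplus> G u)"
    using u by (simp add: ip_add_right GK ipF adjpD[OF r(1)] r(2))
  then have "r u = \<zero>"
    using ip_sum_eq_0(1)[of "r u" "B u"] sum0 by simp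
  then have "rt u = \<zero>"
    using r(2)[of u] adjp_linear(4)[OF r(1)] by simp
  moreover from this have "G u = \<zero>"
    using sum0 by simp
  \<comment> \<open>By self-adjointness \<open>u\<close> is orthogonal to \<open>rt x\<close> and to
    \<open>G x\<close>, hence to their difference, which is \<open>u\<close>.\<close>
  ultimately have "ip u (rt x) = ca_zero A" "ip u (G x) = ca_zero A"
    using adjpD[OF sa_rt, of u x] adjpD[OF \<open>sa G\<close>, of u x] by simp_all
  then have "ip u u = ca_zero A"
    using ip_diff_right[of u "rt x" "G x"] by (simp flip: u_def)
  then have "u = \<zero>"
    by (rule ip_self_zero)
  then show ?thesis
    using x by (simp add: u_def GK)
qed

lemma ell_eq: "ell H K opA = (\<lambda>x. if x \<in> K then rt x else \<zero>)"
  unfolding ell_def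
proof (rule the_equality)
  show "(\<forall>x. x \<notin> K \<longrightarrow> (if x \<in> K then rt x else \<zero>) = \<zero>) \<and>
    positive_on H K (\<lambda>x. if x \<in> K then rt x else \<zero>) \<and>
    (\<forall>x\<in>K. (if (if x \<in> K then rt x else \<zero>) \<in> K then rt (if x \<in> K then rt x else \<zero>) else \<zero>)
      = sq_minus H opA x)"
    using positive_on_rt rt_in_K by (simp add: rt_rt sq_minus_def opT_def)
  fix F assume "(\<forall>x. x \<notin> K \<longrightarrow> F x = \<zero>) \<and> positive_on H K F \<and> (\<forall>x\<in>K. F (F x) = sq_minus H opA x)"
  then have F: "\<And>x. x \<notin> K \<Longrightarrow> F x = \<zero>" "positive_on H K F" "\<And>x. x \<in> K \<Longrightarrow> F (F x) = opT x"
    by (auto simp: sq_minus_def opT_def)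
  show "F = (\<lambda>x. if x \<in> K then rt x else \<zero>)"
    by (rule ext) (simp add: F(1) positive_sqrt_unique[OF F(2,3)])
qed

section \<open>The polar decomposition of \<open>opC\<close>\<close>

text \<open>\<open>opT\<close> is both \<open>c* c\<close> and the square of \<open>rt\<close>.
  Hence sending \<open>rt z\<close> to \<open>opC z\<close> is well defined and isometric.\<close>

lemma ip_opC: "ip (opC z) (opC w) = ip (rt z) (rt w)"
proof -
  have "ip (opC z) (opC w) = ip ((-1) \<cdot> opC z) ((-1) \<cdot> opC w)"
    by (simp add: ip_smul_left ip_smul_right)
  also have "\<dots> = ip z (opT w)"
    unfolding opT_eq by (rule adjpD[OF adjp_sym[OF adjp_opB]])
  also have "\<dots> = ip (rt z) (rt w)"
    by (simp add: adjpD[OF sa_rt] rt_rt)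
  finally show ?thesis .
qed

lemma nm_opC: "nm (opC z) = nm (rt z)"
  by (simp add: hm_norm_def ip_opC)

text \<open>On the range of \<open>opB\<close>, \<open>opT\<close> acts as \<open>b b*\<close>, so
  its image contains the range of \<open>b b* b\<close>, which is dense in the range of
  \<open>b\<close> by \<open>adjp_comp_dense\<close>.\<close>

lemma opT_dense: "cl (opT ` K) = K"
proof
  have "opT ` K \<subseteq> cl K"
    using opT_in_K by (auto simp: closure_K)
  then show "cl (opT ` K) \<subseteq> K"
    using closure_minimal closure_K by blast
  have "opB z \<in> cl (opT ` K)" for z
  proof (rule closureI)
    fix e :: real assume "e > 0"
    then obtain v where v: "nm (opB z \<ominus> opB ((-1) \<cdot> opC (opB v))) < e"
      using adjp_comp_dense[OF adjp_opB] by blast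
    have "opT (opB v) \<in> opT ` K"
      by (rule imageI) (rule opB_in_K)
    moreover have "nm (opT (opB v) \<ominus> opB z) < e"
      using v by (simp only: opT_eq nm_minus_commute)
    ultimately show "\<exists>y\<in>opT ` K. nm (y \<ominus> opB z) < e" ..
  qed
  then have "range opB \<subseteq> cl (opT ` K)"
    by (rule image_subsetI)
  from closure_minimal[OF this] show "K \<subseteq> cl (opT ` K)"
    by (simp only: K_eq)
qed

text \<open>The graph of the unitary \<open>U\<close> in the polar decomposition \<open>opC = U rt\<close>.\<close>
definition polar where
  "polar x y \<longleftrightarrow> (\<exists>z. (\<forall>n. z n \<in> K) \<and> conv (\<lambda>n. rt (z n)) x \<and> conv (\<lambda>n. opC (z n)) y)"

lemma polar_rt: "z \<in> K \<Longrightarrow> polar (rt z) (opC z)"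
  unfolding polar_def by (intro exI[of _ "\<lambda>_. z"]) (simp add: conv_const)

lemma polar_ip:
  assumes "polar x y" "polar x' y'" shows "ip x x' = ip y y'"
proof -
  obtain z where z: "conv (\<lambda>n. rt (z n)) x" "conv (\<lambda>n. opC (z n)) y"
    using assms(1) unfolding polar_def by blast
  obtain w where w: "conv (\<lambda>n. rt (w n)) x'" "conv (\<lambda>n. opC (w n)) y'"
    using assms(2) unfolding polar_def by blast
  show ?thesis
    by (rule conv_ip_eq[OF _ z(1) w(1) z(2) w(2)]) (rule ip_opC[symmetric])
qed

text \<open>Inner products of differences agree on both sides, so a single identity makes the graph
  single-valued and injective.\<close>

lemma polar_unique:
  assumes "polar x y" "polar x' y'" shows "x = x' \<longleftrightarrow> y = y'"
proof -
  have eq: "ip (x \<ominus> x') (x \<ominus> x') = ip (y \<ominus> y') (y \<ominus> y')"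
    using polar_ip[OF assms] polar_ip[OF assms(2,1)] polar_ip[OF assms(1,1)] polar_ip[OF assms(2,2)]
    by (simp add: ip_diff_left ip_diff_right)
  have "x \<ominus> x' = \<zero> \<longleftrightarrow> y \<ominus> y' = \<zero>"
  proof
    assume "x \<ominus> x' = \<zero>"
    then show "y \<ominus> y' = \<zero>"
      using eq by (intro ip_self_zero) (simp only: ip_zero_left)
  next
    assume "y \<ominus> y' = \<zero>"
    then show "x \<ominus> x' = \<zero>"
      using eq by (intro ip_self_zero) (simp only: ip_zero_left)
  qed
  then show ?thesis by simp
qed

text \<open>Elements \<open>opT w\<close> are of the form \<open>rt (rt w)\<close>, so
  \<open>rt\<close> has dense image in \<open>K\<close>; the isometry then transports convergence to
  the values of \<open>opC\<close>.\<close>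

lemma polar_total:
  assumes "x \<in> K" shows "\<exists>y\<in>L. polar x y"
proof -
  have "x \<in> cl (opT ` K)"
    using assms opT_dense by simp
  then obtain X where X: "\<And>n. X n \<in> opT ` K" "conv X x"
    unfolding closure_seq by blast
  have "\<exists>z. z \<in> K \<and> rt z = X n" for n
    using X(1)[of n] rt_in_K rt_rt by (metis imageE)
  then obtain z where z: "\<And>n. z n \<in> K" "\<And>n. rt (z n) = X n"
    by metis
  have z_conv: "conv (\<lambda>n. rt (z n)) x"
    using X(2) z(2) by simp
  have "\<exists>y. conv (\<lambda>n. opC (z n)) y"
    by (rule conv_of_Cauchy_dist[OF z_conv])
      (simp add: nm_opC flip: linC(2) adjp_linear(2)[OF sa_rt])
  then obtain y where y: "conv (\<lambda>n. opC (z n)) y" ..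
  have "y \<in> L"
    unfolding L_eq closure_seq by (intro exI[of _ "\<lambda>n. opC (z n)"] conjI allI rangeI y)
  moreover have "polar x y"
    unfolding polar_def by (intro exI[of _ z] conjI allI z(1) z_conv y)
  ultimately show ?thesis ..
qed

text \<open>By \<open>opC_P5\<close> the range of \<open>opC\<close> is already attained on
  \<open>K\<close>, and convergence is transported back to the values of \<open>rt\<close>.\<close>

lemma polar_onto:
  assumes "y \<in> L" shows "\<exists>x\<in>K. polar x y"
proof -
  obtain Y where Y: "\<And>n. Y n \<in> range opC" "conv Y y"
    using assms unfolding L_eq closure_seq by blast
  have "\<exists>z. z \<in> K \<and> opC z = Y n" for n
    using Y(1)[of n] opC_P5 P5(1) by (metis imageE)
  then obtain z where z: "\<And>n. z n \<in> K" "\<And>n. opC (z n) = Y n"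
    by metis
  have z_conv: "conv (\<lambda>n. opC (z n)) y"
    using Y(2) z(2) by simp
  have "\<exists>x. conv (\<lambda>n. rt (z n)) x"
    by (rule conv_of_Cauchy_dist[OF z_conv])
      (simp add: nm_opC flip: linC(2) adjp_linear(2)[OF sa_rt])
  then obtain x where x: "conv (\<lambda>n. rt (z n)) x" ..
  have "x \<in> cl K"
    unfolding closure_seq by (intro exI[of _ "\<lambda>n. rt (z n)"] conjI allI rt_in_K z(1) x)
  then have "x \<in> K"
    by (simp only: closure_K)
  moreover have "polar x y"
    unfolding polar_def by (intro exI[of _ z] conjI allI z(1) z_conv x)
  ultimately show ?thesis ..
qed

text \<open>The graph is stable under replacing \<open>z\<close> by \<open>z - a z\<close>:
  \<open>rt\<close> commutes with \<open>a\<close>, and \<open>c (1 - a) = d c\<close>. For the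
  unitary this reads \<open>d U = U (1 - a)\<close>, the lower right block.\<close>

lemma polar_intertwine:
  assumes "polar x y" shows "polar (x \<ominus> opA x) (opD y)"
proof -
  obtain z where z: "\<And>n. z n \<in> K" "conv (\<lambda>n. rt (z n)) x" "conv (\<lambda>n. opC (z n)) y"
    using assms unfolding polar_def by blast
  show ?thesis
    unfolding polar_def
  proof (intro exI[of _ "\<lambda>n. z n \<ominus> opA (z n)"] conjI allI)
    show "z n \<ominus> opA (z n) \<in> K" for n
      by (intro subspD(1)[OF subsp_K] z(1) opA_in_K)
    show "conv (\<lambda>n. rt (z n \<ominus> opA (z n))) (x \<ominus> opA x)"
      using conv_diff[OF z(2) conv_adjp[OF sa_opA z(2)]] by (simp add: adjp_linear[OF sa_rt] rt_opA)
    have "opC (z n \<ominus> opA (z n)) = opD (opC (z n))" for n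
      using CA_DC[of "z n"] by (simp add: linC vec.diff_eq_eq vec.add.commute)
    then show "conv (\<lambda>n. opC (z n \<ominus> opA (z n))) (opD y)"
      using conv_adjp[OF sa_opD z(3)] by simp
  qed
qed

definition opU where "opU x = (SOME y. y \<in> L \<and> polar x y)"
definition opV where "opV y = (SOME x. x \<in> K \<and> polar x y)"

lemma opU: "x \<in> K \<Longrightarrow> opU x \<in> L \<and> polar x (opU x)"
  unfolding opU_def using polar_total[of x] by (intro someI_ex[of "\<lambda>y. y \<in> L \<and> polar x y"]) blast

lemma opV: "y \<in> L \<Longrightarrow> opV y \<in> K \<and> polar (opV y) y"
  unfolding opV_def using polar_onto[of y] by (intro someI_ex[of "\<lambda>x. x \<in> K \<and> polar x y"]) blast

lemma opU_eq: "x \<in> K \<Longrightarrow> polar x y \<Longrightarrow> opU x = y"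
  using opU polar_unique by blast

lemma unitary_UV: "unitary_between H K L opU opV"
  unfolding unitary_between_def
proof (intro conjI ballI)
  show "opU ` K \<subseteq> L" "opV ` L \<subseteq> K"
    using opU opV by auto
  show "ip (opU x) y = ip x (opV y)" if "x \<in> K" "y \<in> L" for x y
    using polar_ip[of x "opU x" "opV y" y] opU[OF that(1)] opV[OF that(2)] by simp
  show "opV (opU x) = x" if "x \<in> K" for x
    using polar_unique[of "opV (opU x)" "opU x" x "opU x"] opU[OF that] opV[of "opU x"] by simp
  show "opU (opV y) = y" if "y \<in> L" for y
    using opU_eq[of "opV y" y] opV[OF that] by simp
qed

lemma opC_polar: "x \<in> K \<Longrightarrow> opC x = opU (rt x)"
  using opU_eq[OF rt_in_K polar_rt] by simp

lemma opD_polar: assumes "y \<in> L" shows "opD y = opU (opV y \<ominus> opA (opV y))"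
proof -
  have v: "opV y \<in> K" "polar (opV y) y"
    using opV[OF assms] by auto
  have "opV y \<ominus> opA (opV y) \<in> K"
    by (intro subspD(1)[OF subsp_K] v(1) opA_in_K)
  then show ?thesis
    using opU_eq[OF _ polar_intertwine[OF v(2)]] by simp
qed

text \<open>The adjoint of \<open>c = U rt\<close> gives the claim when tested against vectors of
  \<open>K\<close>. The sum \<open>u\<close> of \<open>opB y\<close> and \<open>rt (opV y)\<close>
  lies in \<open>K\<close>, so it may be tested against itself.\<close>

lemma opB_polar: assumes "y \<in> L" shows "opB y = (-1) \<cdot> rt (opV y)"
proof -
  have v: "opV y \<in> K" "polar (opV y) y"
    using opV[OF assms] by auto
  define u where "u = opB y \<oplus> rt (opV y)"
  have "u \<in> K"
    unfolding u_def by (intro subsp_add subsp_K opB_in_K rt_in_K v)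
  have "ip u (rt (opV y)) = ip (opC u) y"
    using polar_ip[OF polar_rt[OF \<open>u \<in> K\<close>] v(2)] by (simp add: adjpD[OF sa_rt])
  moreover have "ip u (opB y) = ca_smul A (-1) (ip (opC u) y)"
    using adjpD[OF adjp_opC, of u y] by (simp add: ip_smul_right)
  ultimately have "ip u u = ca_zero A"
    using ip_add_right[of u "opB y" "rt (opV y)"] by (simp flip: u_def)
  then have "u = \<zero>"
    by (rule ip_self_zero)
  then show ?thesis
    unfolding u_def by (simp only: vec.add_eq_0_iff2)
qed

section \<open>Orthogonality of the six summands\<close>

lemma orth_PN: "P x = x \<Longrightarrow> P y = \<zero> \<Longrightarrow> ip x y = ca_zero A"
  using adjpD[OF sa_P, of x y] by simp

lemma orth_comm: "ip x y = ca_zero A \<Longrightarrow> ip y x = ca_zero A"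
  using ip_star[of x y] star_zero by simp

lemma range_PQ: "x \<in> range P \<longleftrightarrow> P x = x" "x \<in> range Q \<longleftrightarrow> Q x = x"
  by (metis PP rangeE rangeI, metis QQ rangeE rangeI)

lemma in_H1234:
  "x \<in> H1 H P Q \<longleftrightarrow> P x = x \<and> Q x = x" "x \<in> H2 H P Q \<longleftrightarrow> P x = x \<and> Q x = \<zero>"
  "x \<in> H3 H P Q \<longleftrightarrow> P x = \<zero> \<and> Q x = x" "x \<in> H4 H P Q \<longleftrightarrow> P x = \<zero> \<and> Q x = \<zero>"
  by (simp_all add: H1_def H2_def H3_def H4_def ker_op_def range_PQ)

lemma subsp_H: "subsp (H1 H P Q)" "subsp (H2 H P Q)" "subsp (H3 H P Q)" "subsp (H4 H P Q)"
  unfolding subsp_def by (simp_all add: in_H1234 linP linQ)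

text \<open>Range and kernel of an idempotent need not be orthogonal. Here \<open>R y\<close> is
  \<open>y\<close> or \<open>-y\<close>, so \<open>Q* y = R Q R y\<close> is zero along with
  \<open>Q y\<close>.\<close>

lemma orth_range_ker_Q:
  assumes "Q x = x" "Q y = \<zero>" "P y = y \<or> P y = \<zero>" shows "ip x y = ca_zero A"
proof -
  have "R (Q (R y)) = \<zero>"
    using assms(3)
  proof
    assume "P y = y"
    then show ?thesis
      using assms(2) by (simp add: refl_op_def linP)
  next
    assume "P y = \<zero>"
    then have "R y = (-1) \<cdot> y"
      by (simp add: refl_op_def)
    then show ?thesis
      using assms(2) by (simp add: refl_op_def linQ linP)
  qed
  then show ?thesis
    using adjpD[OF adjp_Q, of x y] assms(1) by simp
qed

text \<open>The conditions say \<open>opC y = 0\<close>, and \<open>opC\<close> is up to sign the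
  adjoint of \<open>opB\<close>. They cover \<open>H1\<close> and \<open>H2\<close> at once.\<close>

lemma orth_K: assumes "x \<in> K" "P y = y" "N (Q y) = \<zero>" shows "ip x y = ca_zero A"
proof (rule closure_orth[of "range opB"])
  show "x \<in> cl (range opB)" using assms(1) by (simp only: K_eq)
  fix w assume "w \<in> range opB"
  then obtain z where z: "w = opB z" ..
  have "opC y = \<zero>"
    using assms(2,3) by (simp add: opC_def)
  then show "ip w y = ca_zero A"
    using adjpD[OF adjp_opB, of z y] z by simp
qed

lemma orth_L: assumes "x \<in> L" "P y = \<zero>" "P (Q y) = \<zero>" shows "ip x y = ca_zero A"
proof (rule closure_orth[of "range opC"])
  show "x \<in> cl (range opC)" using assms(1) by (simp only: L_eq)
  fix w assume "w \<in> range opC"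
  then obtain z where z: "w = opC z" ..
  have "opB y = \<zero>"
    using assms(2,3) by (simp add: opB_def)
  then show "ip w y = ca_zero A"
    using adjpD[OF adjp_opC, of z y] z by simp
qed

lemma mutually_orth:
  "x \<in> H1 H P Q \<Longrightarrow> y \<in> H2 H P Q \<Longrightarrow> ip x y = ca_zero A"
  "x \<in> H3 H P Q \<Longrightarrow> y \<in> H4 H P Q \<Longrightarrow> ip x y = ca_zero A"
  "x \<in> K \<Longrightarrow> y \<in> H1 H P Q \<Longrightarrow> ip x y = ca_zero A"
  "x \<in> K \<Longrightarrow> y \<in> H2 H P Q \<Longrightarrow> ip x y = ca_zero A"
  "x \<in> L \<Longrightarrow> y \<in> H3 H P Q \<Longrightarrow> ip x y = ca_zero A"
  "x \<in> L \<Longrightarrow> y \<in> H4 H P Q \<Longrightarrow> ip x y = ca_zero A"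
  "x \<in> H1 H P Q \<Longrightarrow> y \<in> H3 H P Q \<Longrightarrow> ip x y = ca_zero A"
  "x \<in> H1 H P Q \<Longrightarrow> y \<in> H4 H P Q \<Longrightarrow> ip x y = ca_zero A"
  "x \<in> H1 H P Q \<Longrightarrow> y \<in> L \<Longrightarrow> ip x y = ca_zero A"
  "x \<in> H2 H P Q \<Longrightarrow> y \<in> H3 H P Q \<Longrightarrow> ip x y = ca_zero A"
  "x \<in> H2 H P Q \<Longrightarrow> y \<in> H4 H P Q \<Longrightarrow> ip x y = ca_zero A"
  "x \<in> H2 H P Q \<Longrightarrow> y \<in> L \<Longrightarrow> ip x y = ca_zero A"
  "x \<in> K \<Longrightarrow> y \<in> H3 H P Q \<Longrightarrow> ip x y = ca_zero A"
  "x \<in> K \<Longrightarrow> y \<in> H4 H P Q \<Longrightarrow> ip x y = ca_zero A"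
  "x \<in> K \<Longrightarrow> y \<in> L \<Longrightarrow> ip x y = ca_zero A"
  by (auto simp: in_H1234 P_K P_L linP(4) intro: orth_PN orth_range_ker_Q orth_K orth_L)

lemmas mutually_orth' = mutually_orth[THEN orth_comm]

text \<open>Each projection is recognised from the explicit orthogonal decomposition. Block forms
  then follow once \<open>P\<close> or \<open>Q\<close> of \<open>U_PQ_adj y\<close> is again
  written as \<open>U_PQ_adj\<close> of a tuple with components in the six summands.\<close>

lemma U_PQ_U_PQ_adj:
  assumes y: "y1 \<in> H1 H P Q" "y2 \<in> H2 H P Q" "y3 \<in> H3 H P Q" "y4 \<in> H4 H P Q" "y5 \<in> K" "y6 \<in> L"
  shows "U_PQ A H P Q (U_PQ_adj H (y1, y2, y3, y4, y5, y6)) = (y1, y2, y3, y4, y5, y6)"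
proof -
  note orth = mutually_orth mutually_orth'
  have "orth_proj H (H1 H P Q) (U_PQ_adj H (y1, y2, y3, y4, y5, y6)) = y1"
    by (rule orth_proj_eq) (use y in \<open>simp_all add: U_PQ_adj_def in_orth ip_simps orth subsp_H subsp_K subsp_L\<close>)
  moreover
  have "orth_proj H (H2 H P Q) (U_PQ_adj H (y1, y2, y3, y4, y5, y6)) = y2"
    by (rule orth_proj_eq) (use y in \<open>simp_all add: U_PQ_adj_def in_orth ip_simps orth subsp_H subsp_K subsp_L\<close>)
  moreover
  have "orth_proj H (H3 H P Q) (U_PQ_adj H (y1, y2, y3, y4, y5, y6)) = y3"
    by (rule orth_proj_eq) (use y in \<open>simp_all add: U_PQ_adj_def in_orth ip_simps orth subsp_H subsp_K subsp_L\<close>)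
  moreover
  have "orth_proj H (H4 H P Q) (U_PQ_adj H (y1, y2, y3, y4, y5, y6)) = y4"
    by (rule orth_proj_eq) (use y in \<open>simp_all add: U_PQ_adj_def in_orth ip_simps orth subsp_H subsp_K subsp_L\<close>)
  moreover
  have "orth_proj H (K) (U_PQ_adj H (y1, y2, y3, y4, y5, y6)) = y5"
    by (rule orth_proj_eq) (use y in \<open>simp_all add: U_PQ_adj_def in_orth ip_simps orth subsp_H subsp_K subsp_L\<close>)
  moreover
  have "orth_proj H (L) (U_PQ_adj H (y1, y2, y3, y4, y5, y6)) = y6"
    by (rule orth_proj_eq) (use y in \<open>simp_all add: U_PQ_adj_def in_orth ip_simps orth subsp_H subsp_K subsp_L\<close>)
  ultimately show ?thesis
    by (simp add: U_PQ_def)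
qed

text \<open>\<open>opB\<close> and \<open>opC\<close> are adjoint up to sign, so they vanish
  together, leaving \<open>Q\<close> as the sum of its self-adjoint corners. Conversely, for
  self-adjoint \<open>Q\<close> the adjoint of \<open>opB\<close> is also \<open>opC\<close> without
  the sign, which forces \<open>opC = - opC\<close>.\<close>

lemma H5_zero_iff: "K = {\<zero>} \<longleftrightarrow> L = {\<zero>}" and H6_zero_iff: "L = {\<zero>} \<longleftrightarrow> Q = adj H Q"
proof -
  have K0: "K = {\<zero>} \<longleftrightarrow> (\<forall>x. opB x = \<zero>)"
    unfolding K_eq by (rule closure_range_zero_iff)
  have L0: "L = {\<zero>} \<longleftrightarrow> (\<forall>x. opC x = \<zero>)"
    unfolding L_eq by (rule closure_range_zero_iff)
  have BC: "(\<forall>x. opB x = \<zero>) \<longleftrightarrow> (\<forall>x. opC x = \<zero>)"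
    using adjp_zero_iff[OF adjp_opB] by simp
  show "K = {\<zero>} \<longleftrightarrow> L = {\<zero>}"
    unfolding K0 L0 by (rule BC)
  show "L = {\<zero>} \<longleftrightarrow> Q = adj H Q"
    unfolding L0
  proof
    assume C0: "\<forall>x. opC x = \<zero>"
    then have B0: "\<forall>x. opB x = \<zero>"
      using BC by blast
    have "Q x = opA x \<oplus> opD x" for x
    proof -
      have "Q x = Q (P x) \<oplus> Q (N x)"
        by (simp flip: linQ(1))
      also have "\<dots> = opA x \<oplus> opD x"
        unfolding Q_P Q_N using B0 C0 by simp
      finally show ?thesis .
    qed
    then have "Q = (\<lambda>x. opA x \<oplus> opD x)" ..
    then have "sa Q"
      using adjp_add[OF sa_opA sa_opD] by simp
    then show "Q = adj H Q"
      unfolding adj_Q by (rule adjp_unique[OF _ adjp_Q])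
  next
    assume "Q = adj H Q"
    then have "sa Q"
      using adjp_Q adj_Q by simp
    then have "adjp opB opC"
      using adjp_comp[OF sa_P adjp_comp[OF _ sa_N], of Q Q]
      by (simp add: opB_def[abs_def] opC_def[abs_def])
    then have eq: "opC x = (-1) \<cdot> opC x" for x
      using adjp_unique[OF _ adjp_opB] by metis
    show "\<forall>x. opC x = \<zero>"
    proof
      fix x
      have "2 * nm (opC x) = 0"
        using eq[of x] nm_smul[of 2 "opC x"] smul_two[of "opC x"] vec.right_minus[of "opC x"] by simp
      then show "opC x = \<zero>" by simp
    qed
  qed
qed

section \<open>Block forms of \<open>P\<close> and \<open>Q\<close>\<close>

lemma dsum_carrier_iff:
  "(y1, y2, y3, y4, y5, y6) \<in> dsum_carrier A H P Q \<longleftrightarrow> y1 \<in> H1 H P Q \<and> y2 \<in> H2 H P Q \<and>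
     y3 \<in> H3 H P Q \<and> y4 \<in> H4 H P Q \<and> y5 \<in> K \<and> y6 \<in> L"
  by (simp add: dsum_carrier_def)

lemma block_P:
  assumes "(y1, y2, y3, y4, y5, y6) \<in> dsum_carrier A H P Q"
  shows "U_PQ A H P Q (P (U_PQ_adj H (y1, y2, y3, y4, y5, y6))) = (y1, y2, \<zero>, \<zero>, y5, \<zero>)"
proof -
  have "P (U_PQ_adj H (y1, y2, y3, y4, y5, y6)) = U_PQ_adj H (y1, y2, \<zero>, \<zero>, y5, \<zero>)"
    using assms by (simp add: U_PQ_adj_def dsum_carrier_iff in_H1234 P_K P_L linP)
  then show ?thesis
    using assms subsp_H subsp_K subsp_L
    by (simp add: U_PQ_U_PQ_adj dsum_carrier_iff subspD(2))
qed

lemma block_Q: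
  assumes "(y1, y2, y3, y4, y5, y6) \<in> dsum_carrier A H P Q"
  shows "U_PQ A H P Q (Q (U_PQ_adj H (y1, y2, y3, y4, y5, y6))) =
    (y1, \<zero>, y3, \<zero>, fst (Qhat H K opA opU opV (y5, y6)), snd (Qhat H K opA opU opV (y5, y6)))"
proof -
  have y: "y1 \<in> H1 H P Q" "y2 \<in> H2 H P Q" "y3 \<in> H3 H P Q" "y4 \<in> H4 H P Q" "y5 \<in> K" "y6 \<in> L"
    using assms unfolding dsum_carrier_iff by blast+
  have v: "opV y6 \<in> K"
    using opV[OF y(6)] by blast
  define q5 where "q5 = fst (Qhat H K opA opU opV (y5, y6))"
  define q6 where "q6 = snd (Qhat H K opA opU opV (y5, y6))"
  have q5: "q5 = opA y5 \<oplus> opB y6"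
    using v by (simp add: q5_def Qhat_def ell_eq opB_polar[OF y(6)])
  have q6: "q6 = opC y5 \<oplus> opD y6"
    using y(5) by (simp add: q6_def Qhat_def ell_eq opC_polar[OF y(5)] opD_polar[OF y(6)])
  have Q5: "Q y5 = opA y5 \<oplus> opC y5"
    using Q_P[of y5] P_K[OF y(5)] by simp
  have Q6: "Q y6 = opB y6 \<oplus> opD y6"
    using Q_N[of y6] P_L[OF y(6)] by simp
  \<comment> \<open>The entries must lie in \<open>K\<close> and \<open>L\<close> before the image
    tuple can be read off by \<open>U_PQ_U_PQ_adj\<close>.\<close>
  have "q5 \<in> K"
    unfolding q5 by (intro subsp_add subsp_K opA_in_K y opB_in_K)
  have "opD y6 \<in> L"
    unfolding opD_polar[OF y(6)] using opU[of "opV y6 \<ominus> opA (opV y6)"] opA_in_K[OF v] v subspD(1)[OF subsp_K]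
    by blast
  then have "q6 \<in> L"
    unfolding q6 by (intro subsp_add subsp_L opC_in_L)
  have "Q (U_PQ_adj H (y1, y2, y3, y4, y5, y6)) = U_PQ_adj H (y1, \<zero>, y3, \<zero>, q5, q6)"
    using y(1-4) by (simp add: U_PQ_adj_def linQ Q5 Q6 q5 q6 in_H1234 vec.add_ac)
  then show ?thesis
    using y \<open>q5 \<in> K\<close> \<open>q6 \<in> L\<close> subsp_H
    by (simp add: U_PQ_U_PQ_adj subspD(2) flip: q5_def q6_def)
qed

lemma selfadjoint_on_opA: "selfadjoint_on H K opA"
  unfolding selfadjoint_on_def using opA_in_K adjpD[OF sa_opA] by auto

lemma sq_minus_opA: "sq_minus H opA = opT"
  by (simp add: sq_minus_def opT_def[abs_def])

lemma positive_on_opT: "positive_on H K opT"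
  unfolding positive_on_def
  by (intro conjI exI[of _ rt]) (use rt_in_K opT_in_K in \<open>auto simp: adjpD[OF sa_rt] rt_rt\<close>)

end

theorem theorem4p2:
  fixes A :: "'a cstar_alg" and H :: "('m, 'a) hilb_mod" and P Q :: "'m \<Rightarrow> 'm"
  assumes "hilbert_module A H"
    and "harmonious A H P Q"
    and "P \<noteq> (\<lambda>_. hm_zero H)" and "P \<noteq> id"
  shows "(H5 A H P Q \<noteq> {hm_zero H} \<longleftrightarrow> H6 A H P Q \<noteq> {hm_zero H}) \<and>
         (H6 A H P Q \<noteq> {hm_zero H} \<longleftrightarrow> Q \<noteq> adj H Q) \<and>
         (Q \<noteq> adj H Q \<longrightarrow>
            (\<forall>y\<in>dsum_carrier A H P Q.
               U_PQ A H P Q (P (U_PQ_adj H y)) =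
                 (case y of (y1, y2, y3, y4, y5, y6) \<Rightarrow>
                    (y1, y2, hm_zero H, hm_zero H, y5, hm_zero H))) \<and>
            (\<exists>T U V. selfadjoint_on H (H5 A H P Q) T \<and>
                     positive_on H (H5 A H P Q) (sq_minus H T) \<and>
                     hm_closure A H (sq_minus H T ` H5 A H P Q) = H5 A H P Q \<and>
                     unitary_between H (H5 A H P Q) (H6 A H P Q) U V \<and>
                     (\<forall>y\<in>dsum_carrier A H P Q.
                        U_PQ A H P Q (Q (U_PQ_adj H y)) =
                          (case y of (y1, y2, y3, y4, y5, y6) \<Rightarrow>
                             (y1, hm_zero H, y3, hm_zero H,
                              fst (Qhat H (H5 A H P Q) T U V (y5, y6)),
                              snd (Qhat H (H5 A H P Q) T U V (y5, y6)))))))"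
proof -
  interpret hilb_module_cs A H
    by (rule hilb_module_csI[OF assms(1)])
  interpret harmonious_pair A H P Q
    by unfold_locales (rule assms(2))
  show ?thesis
  proof (intro conjI impI ballI;
      (rule exI[of _ opA], rule exI[of _ opU], rule exI[of _ opV], intro conjI ballI)?)
    fix y assume y: "y \<in> dsum_carrier A H P Q"
    obtain y1 y2 y3 y4 y5 y6 where y_eq: "y = (y1, y2, y3, y4, y5, y6)"
      by (metis prod_cases6)
    show "U_PQ A H P Q (P (U_PQ_adj H y)) =
        (case y of (y1, y2, y3, y4, y5, y6) \<Rightarrow> (y1, y2, hm_zero H, hm_zero H, y5, hm_zero H))"
      using block_P y unfolding y_eq by simp
    show "U_PQ A H P Q (Q (U_PQ_adj H y)) = (case y of (y1, y2, y3, y4, y5, y6) \<Rightarrow>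
        (y1, hm_zero H, y3, hm_zero H, fst (Qhat H (H5 A H P Q) opA opU opV (y5, y6)),
          snd (Qhat H (H5 A H P Q) opA opU opV (y5, y6))))"
      using block_Q y unfolding y_eq by simp
  qed (simp_all add: H5_zero_iff H6_zero_iff selfadjoint_on_opA sq_minus_opA positive_on_opT opT_dense
      unitary_UV)
qed

end
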